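(* Let $\mathcal U$ be a vector superspace and let $a(Z,W)$ be a local $\mathcal U$-valued formal distribution in the two sets of variables $Z,W$. Then $a(Z,W)$ can be uniquely decomposed as the finite sum $$a(Z,W)=\sum_{(j|J):\,j\ge 0}\bigl(D_W^{(j|J)}\delta(Z,W)\bigr)\,c_{j|J}(W),$$ where the $c_{j|J}(W)$ are $\mathcal U$-valued formal distributions in $W$. The coefficients are given by $$c_{j|J}(W)=\mathrm{res}_Z\,(Z-W)^{j|J}\,a(Z,W).$$
   Context: Ground field $\mathbb C$; $N\ge 1$ is a fixed integer. $Z=(z,\theta^1,\dots,\theta^N)$, $W=(w,\zeta^1,\dots,\zeta^N)$ with $z,w$ even and $\theta^i,\zeta^i$ odd variables, all supercommuting with one another (in particular all odd variables anticommute). For a subset $J=\{j_1<\dots<j_k\}\subset\{1,\dots,N\}$: $\theta^J=\theta^{j_1}\cdots\theta^{j_k}$, $Z^{j|J}=z^j\theta^J$, $\theta^N=\theta^1\cdots\theta^N$. In exponents of $-1$ we write $J$ for $\#J$. A $\mathcal U$-valued formal distribution in $Z$ is a formal sum $\sum_{n\in\mathbb Z,I}Z^{n|I}a_{n|I}$ with arbitrary $a_{n|I}\in\mathcal U$ (similarly in two sets of variables); $\mathrm{res}_Z$ denotes the coefficient of $Z^{-1|N}=z^{-1}\theta^1\cdots\theta^N$, the coefficient being written to the right of $Z^{-1|N}$. A distribution $a(Z,W)$ is local if $(z-w)^na(Z,W)=0$ for some integer $n\ge0$. Here (the "$N_K=N$" conventions) $(Z-W)^{j|J}=\bigl(z-w-\sum_{i=1}^N\theta^i\zeta^i\bigr)^j\prod_{i\in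 J}(\theta^i-\zeta^i)$ (product in increasing order); $D^i_W=\partial_{\zeta^i}+\zeta^i\partial_w$, $D_W^{j|J}=\partial_w^jD_W^{j_1}\cdots D_W^{j_k}$ and $D_W^{(j|J)}=\frac{(-1)^{J(J+1)/2}}{j!}D_W^{j|J}$. $\delta(Z,W)=(i_{z,w}-i_{w,z})\frac{(\theta^1-\zeta^1)\cdots(\theta^N-\zeta^N)}{z-w}$, where $i_{z,w}$ (resp. $i_{w,z}$) is expansion in the domain $|z|>|w|$ (resp. $|w|>|z|$). *)

theory Defs
  imports Complex_Main "HOL-Library.Function_Algebras"
begin

text \<open>
  The odd variables of each of the sets \<open>Z\<close>, \<open>W\<close> are indexed by a finite linearly ordered type
  \<open>'n\<close>, which plays the role of \<open>{1, \<dots>, N}\<close>; in particular \<open>N = CARD('n) \<ge> 1\<close>, and the full index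
  set is \<^term>\<open>UNIV :: 'n set\<close>.  Zero and addition of formal distributions are pointwise, as provided
  by \<^theory>\<open>HOL-Library.Function_Algebras\<close>; the pointwise product of that theory is never used.
\<close>

locale vector_superspace = vector_space scale
  for scale :: "complex \<Rightarrow> 'u::ab_group_add \<Rightarrow> 'u" +
  fixes U_even U_odd :: "'u set"
  assumes subspace_even: "subspace U_even"
    and subspace_odd: "subspace U_odd"
    and Int_even_odd: "U_even \<inter> U_odd = {0}"
    and even_plus_odd: "\<And>u. \<exists>x\<in>U_even. \<exists>y\<in>U_odd. u = x + y"

text \<open>
  A distribution \<open>c\<close> in \<open>W\<close> stands for the formal sum of all \<open>w\<^sup>m \<zeta>\<^sup>K (c m K)\<close>, and a distribution
  \<open>a\<close> in \<open>Z, W\<close> for the formal sum of all \<open>z\<^sup>n \<theta>\<^sup>I w\<^sup>m \<zeta>\<^sup>K (a n I m K)\<close>.  Coefficients always stand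
  to the right of the monomials, so no sign involving the parity of a coefficient ever occurs.
\<close>

type_synonym ('n, 'u) dist_W = "int \<Rightarrow> 'n set \<Rightarrow> 'u"
type_synonym ('n, 'u) dist_ZW = "int \<Rightarrow> 'n set \<Rightarrow> int \<Rightarrow> 'n set \<Rightarrow> 'u"

definition in_W :: "('n, 'u::zero) dist_W \<Rightarrow> ('n, 'u) dist_ZW" where
  "in_W c = (\<lambda>n I m K. if n = 0 \<and> I = {} then c m K else 0)"

definition res_Z :: "('n, 'u) dist_ZW \<Rightarrow> ('n, 'u) dist_W" where
  "res_Z a = (\<lambda>m K. a (-1) UNIV m K)"


text \<open>For disjoint \<open>A, B\<close>: \<open>\<theta>\<^sup>A \<theta>\<^sup>B = (-1)^(inversions A B) \<theta>\<^sup>A\<^sup>\<union>\<^sup>B\<close>.\<close>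

definition inversions :: "'n::linorder set \<Rightarrow> 'n set \<Rightarrow> nat" where
  "inversions A B = card {(i, j). i \<in> A \<and> j \<in> B \<and> j < i}"

text \<open>The sign in \<open>(\<theta>\<^sup>I \<zeta>\<^sup>K) (\<theta>\<^sup>I\<^sup>' \<zeta>\<^sup>K\<^sup>') = \<plusminus> \<theta>\<^sup>I\<^sup>\<union>\<^sup>I\<^sup>' \<zeta>\<^sup>K\<^sup>\<union>\<^sup>K\<^sup>'\<close>, where \<open>I \<inter> I' = K \<inter> K' = {}\<close>.\<close>

definition koszul_sign :: "'n::linorder set \<Rightarrow> 'n set \<Rightarrow> 'n set \<Rightarrow> 'n set \<Rightarrow> complex" where
  "koszul_sign I K I' K' = (-1) ^ (card K * card I' + inversions I I' + inversions K K')"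

text \<open>
  The product of a scalar-valued and a \<open>'u\<close>-valued distribution.  Each coefficient is the sum of the
  nonzero contributions to it; the product is meaningful only if these are finitely many in every
  degree (\<^const>\<open>sum\<close> being \<open>0\<close> over infinite sets).  This is the case whenever the first factor is a
  Laurent polynomial, and for the product of \<open>D_W\<^sup>(\<^sup>j\<^sup>|\<^sup>J\<^sup>)\<delta>(Z,W)\<close> with a distribution in \<open>W\<close>.
\<close>

definition dist_mult ::
  "(complex \<Rightarrow> 'u \<Rightarrow> 'u) \<Rightarrow> ('n::{finite,linorder}, complex) dist_ZW \<Rightarrow>
    ('n, 'u::ab_group_add) dist_ZW \<Rightarrow> ('n, 'u) dist_ZW" where
  "dist_mult scale p a = (\<lambda>n I m K.
     \<Sum>(n', I', m', K') \<in> {(n', I', m', K'). I' \<subseteq> I \<and> K' \<subseteq> K \<and>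
         p n' I' m' K' \<noteq> 0 \<and> a (n - n') (I - I') (m - m') (K - K') \<noteq> 0}.
       scale (koszul_sign I' K' (I - I') (K - K') * p n' I' m' K')
         (a (n - n') (I - I') (m - m') (K - K')))"

definition monomial_ZW ::
  "int \<Rightarrow> 'n set \<Rightarrow> int \<Rightarrow> 'n set \<Rightarrow> ('n, complex) dist_ZW" where
  "monomial_ZW n I m K =
     (\<lambda>n' I' m' K'. if n' = n \<and> I' = I \<and> m' = m \<and> K' = K then 1 else 0)"

abbreviation "one_ZW \<equiv> monomial_ZW 0 {} 0 {}"
abbreviation "var_z \<equiv> monomial_ZW 1 {} 0 {}"
abbreviation "var_w \<equiv> monomial_ZW 0 {} 1 {}"
abbreviation "var_\<theta> i \<equiv> monomial_ZW 0 {i} 0 {}"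
abbreviation "var_\<zeta> i \<equiv> monomial_ZW 0 {} 0 {i}"

definition dist_power ::
  "('n::{finite,linorder}, complex) dist_ZW \<Rightarrow> nat \<Rightarrow> ('n, complex) dist_ZW" where
  "dist_power p k = (dist_mult (*) p ^^ k) one_ZW"

definition local_dist ::
  "(complex \<Rightarrow> 'u \<Rightarrow> 'u) \<Rightarrow> ('n::{finite,linorder}, 'u::ab_group_add) dist_ZW \<Rightarrow> bool" where
  "local_dist scale a \<longleftrightarrow> (\<exists>k::nat. dist_mult scale (dist_power (var_z - var_w) k) a = 0)"


text \<open>The product of the \<open>\<theta>\<^sup>i - \<zeta>\<^sup>i\<close> over \<open>i \<in> J\<close>, in increasing order.\<close>

definition odd_diff_prod :: "'n::{finite,linorder} set \<Rightarrow> ('n, complex) dist_ZW" where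
  "odd_diff_prod J =
     foldr (\<lambda>i. dist_mult (*) (var_\<theta> i - var_\<zeta> i)) (sorted_list_of_set J) one_ZW"

definition ZW_diff_power :: "nat \<Rightarrow> 'n::{finite,linorder} set \<Rightarrow> ('n, complex) dist_ZW" where
  "ZW_diff_power j J =
     dist_mult (*)
       (dist_power (var_z - var_w - (\<Sum>i\<in>UNIV. dist_mult (*) (var_\<theta> i) (var_\<zeta> i))) j)
       (odd_diff_prod J)"


text \<open>
  The expansions of \<open>1 / (z - w)\<close>: the sum of all \<open>z\<^sup>-\<^sup>k\<^sup>-\<^sup>1 w\<^sup>k\<close> with \<open>k \<ge> 0\<close> for \<open>|z| > |w|\<close>, and minus
  the sum of all \<open>z\<^sup>k w\<^sup>-\<^sup>k\<^sup>-\<^sup>1\<close> with \<open>k \<ge> 0\<close> for \<open>|w| > |z|\<close>.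
\<close>

definition i_zw_inverse :: "('n, complex) dist_ZW" where
  "i_zw_inverse = (\<lambda>n I m K. if I = {} \<and> K = {} \<and> m \<ge> 0 \<and> n = - m - 1 then 1 else 0)"

definition i_wz_inverse :: "('n, complex) dist_ZW" where
  "i_wz_inverse = (\<lambda>n I m K. if I = {} \<and> K = {} \<and> n \<ge> 0 \<and> m = - n - 1 then - 1 else 0)"

definition delta_ZW :: "('n::{finite,linorder}, complex) dist_ZW" where
  "delta_ZW = dist_mult (*) (odd_diff_prod UNIV) i_zw_inverse
            - dist_mult (*) (odd_diff_prod UNIV) i_wz_inverse"


definition deriv_w :: "('n, complex) dist_ZW \<Rightarrow> ('n, complex) dist_ZW" where
  "deriv_w a = (\<lambda>n I m K. of_int (m + 1) * a n I (m + 1) K)"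

text \<open>The left derivative: \<open>\<partial>\<close> is moved past \<open>\<theta>\<^sup>I\<close> and past the \<open>\<zeta>\<^sup>k\<close> with \<open>k < i\<close>.\<close>

definition deriv_\<zeta> :: "'n::linorder \<Rightarrow> ('n, complex) dist_ZW \<Rightarrow> ('n, complex) dist_ZW" where
  "deriv_\<zeta> i a = (\<lambda>n I m K. if i \<in> K then 0
     else (-1) ^ (card I + card {k \<in> K. k < i}) * a n I m (insert i K))"

definition D_W ::
  "'n::{finite,linorder} \<Rightarrow> ('n, complex) dist_ZW \<Rightarrow> ('n, complex) dist_ZW" where
  "D_W i a = deriv_\<zeta> i a + dist_mult (*) (var_\<zeta> i) (deriv_w a)"

definition D_W_power ::
  "nat \<Rightarrow> 'n::{finite,linorder} set \<Rightarrow> ('n, complex) dist_ZW \<Rightarrow> ('n, complex) dist_ZW" where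
  "D_W_power j J a = (deriv_w ^^ j) (foldr D_W (sorted_list_of_set J) a)"

definition D_W_divided ::
  "nat \<Rightarrow> 'n::{finite,linorder} set \<Rightarrow> ('n, complex) dist_ZW \<Rightarrow> ('n, complex) dist_ZW" where
  "D_W_divided j J a = (\<lambda>n I m K.
     (-1) ^ (card J * (card J + 1) div 2) / fact j * D_W_power j J a n I m K)"


text \<open>A finite sum over all \<open>(j|J)\<close> means that almost all of the \<open>c j J\<close> vanish.\<close>

definition is_delta_decomposition ::
  "(complex \<Rightarrow> 'u \<Rightarrow> 'u) \<Rightarrow> ('n::{finite,linorder}, 'u::ab_group_add) dist_ZW \<Rightarrow>
    (nat \<Rightarrow> 'n set \<Rightarrow> ('n, 'u) dist_W) \<Rightarrow> bool" where
  "is_delta_decomposition scale a c \<longleftrightarrow>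
     finite {(j, J). c j J \<noteq> 0} \<and>
     a = (\<Sum>(j, J) \<in> {(j, J). c j J \<noteq> 0}.
            dist_mult scale (D_W_divided j J delta_ZW) (in_W (c j J)))"

end

theory Submission
  imports Defs
begin

text \<open>
  Write \<open>X = z - w - \<Sum> \<theta>\<^sup>i \<zeta>\<^sup>i\<close>, \<open>X\<^sub>i = \<theta>\<^sup>i - \<zeta>\<^sup>i\<close> and \<open>D\<^sub>i = D\<^sub>W\<^sup>i\<close>.  As operators, \<open>[D\<^sub>i, X] = X\<^sub>i\<close>,
  \<open>D\<^sub>i X\<^sub>j + X\<^sub>j D\<^sub>i = - \<delta>\<^sub>i\<^sub>j\<close> and \<open>[\<partial>\<^sub>w, X] = - 1\<close>, while \<open>X\<close> and all \<open>X\<^sub>i\<close> annihilate \<open>\<delta>(Z,W)\<close>.  Hence the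
  moments \<open>res\<^sub>Z (Z - W)\<^sup>j\<^sup>|\<^sup>J\<close> of \<open>D\<^sub>W\<^sup>(\<^sup>n\<^sup>|\<^sup>I\<^sup>)\<delta>\<close> vanish except for \<open>(n|I) = (j|J)\<close>, where the moment is \<open>1\<close>;
  this gives the coefficient formula and uniqueness.

  For existence, subtract from \<open>a\<close> the decomposition built from its moments.  The difference \<open>b\<close> is
  local and all its moments vanish.  Distributions without moments are stable under \<open>X\<close>, \<open>X\<^sub>i\<close>, \<open>\<zeta>\<^sup>i\<close>,
  hence under \<open>\<theta>\<^sup>i = X\<^sub>i + \<zeta>\<^sup>i\<close> and \<open>z - w\<close>; multiplying by products of the \<open>\<theta>\<^sup>i\<close> shows that all their
  coefficients at \<open>z\<^sup>-\<^sup>1\<close> vanish.  A solution of \<open>(z - w) b = 0\<close> is determined by these coefficients,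
  and induction on the order of locality gives \<open>b = 0\<close>.
\<close>

lemmas dist_apply = minus_apply uminus_apply plus_fun_apply zero_fun_apply

declare dist_apply [simp del] \<comment> \<open>they would unfold sums and differences below an \<open>\<eta>\<close>-expansion\<close>

section \<open>Koszul signs\<close>

lemma inversions_Un_left:
  fixes A B C :: "'n::{finite,linorder} set"
  assumes "A \<inter> B = {}"
  shows "inversions (A \<union> B) C = inversions A C + inversions B C"
proof -
  have "{(i, j). i \<in> A \<union> B \<and> j \<in> C \<and> j < i} =
      {(i, j). i \<in> A \<and> j \<in> C \<and> j < i} \<union> {(i, j). i \<in> B \<and> j \<in> C \<and> j < i}"
    by auto
  then show ?thesis
    unfolding inversions_def using assms by (auto intro!: card_Un_disjoint)
qed

lemma inversions_Un_right:
  fixes A B C :: "'n::{finite,linorder} set"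
  assumes "B \<inter> C = {}"
  shows "inversions A (B \<union> C) = inversions A B + inversions A C"
proof -
  have "{(i, j). i \<in> A \<and> j \<in> B \<union> C \<and> j < i} =
      {(i, j). i \<in> A \<and> j \<in> B \<and> j < i} \<union> {(i, j). i \<in> A \<and> j \<in> C \<and> j < i}"
    by auto
  then show ?thesis
    unfolding inversions_def using assms by (auto intro!: card_Un_disjoint)
qed

lemma inversions_empty [simp]: "inversions {} A = 0" "inversions A {} = 0"
  by (simp_all add: inversions_def)

lemma inversions_singleton:
  fixes K :: "'n::{finite,linorder} set"
  shows "inversions {i} K = card {k \<in> K. k < i}"
proof -
  have "{(i', j). i' \<in> {i} \<and> j \<in> K \<and> j < i'} = Pair i ` {k \<in> K. k < i}"
    by auto
  then show ?thesis
    by (simp add: inversions_def card_image inj_on_def)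
qed

text \<open>Every pair in \<open>A \<times> B\<close> is out of order in exactly one of the two
  concatenations.\<close>

lemma inversions_add_commute:
  fixes A B :: "'n::{finite,linorder} set"
  assumes "A \<inter> B = {}"
  shows "inversions A B + inversions B A = card A * card B"
proof -
  let ?S = "{(i, j). i \<in> A \<and> j \<in> B \<and> j < i}"
  let ?T = "{(i, j). i \<in> B \<and> j \<in> A \<and> j < i}"
  have "card ?T = card (prod.swap ` ?T)"
    by (simp add: card_image)
  moreover have "A \<times> B = ?S \<union> prod.swap ` ?T"
    using assms by (auto simp: image_iff)
  moreover have "?S \<inter> prod.swap ` ?T = {}"
    by auto
  ultimately show ?thesis
    unfolding inversions_def card_cartesian_product [symmetric]
    by (metis (no_types, lifting) card_Un_disjoint finite_Un finite_code)
qed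

text \<open>Associativity of the monomial product at the level of signs: the exponent is additive
  under disjoint unions in either factor, so both sides expand into the same pairwise terms.\<close>

lemma koszul_sign_cocycle:
  fixes A :: "'n::{finite,linorder} set"
  assumes "A \<inter> B = {}" "(A \<union> B) \<inter> C = {}" "K \<inter> L = {}" "(K \<union> L) \<inter> M = {}"
  shows "koszul_sign A K B L * koszul_sign (A \<union> B) (K \<union> L) C M =
    koszul_sign A K (B \<union> C) (L \<union> M) * koszul_sign B L C M"
proof -
  have "A \<inter> C = {}" "B \<inter> C = {}" "K \<inter> M = {}" "L \<inter> M = {}"
    using assms by auto
  then show ?thesis
    using assms
    by (simp add: koszul_sign_def inversions_Un_left inversions_Un_right card_Un_disjoint
        algebra_simps flip: power_add)
qed

text \<open>The exponents of the two Koszul signs add up to the product of the two parities, by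
  \<open>inversions_add_commute\<close> applied to the theta and to the zeta indices.\<close>

lemma koszul_sign_commute:
  fixes A :: "'n::{finite,linorder} set"
  assumes "A \<inter> B = {}" "K \<inter> L = {}"
  shows "koszul_sign A K B L =
    (-1) ^ ((card A + card K) * (card B + card L)) * koszul_sign B L A K"
proof -
  have "card A * card B = inversions A B + inversions B A"
    "card K * card L = inversions K L + inversions L K"
    using assms by (simp_all add: inversions_add_commute)
  then have "(card A + card K) * (card B + card L) +
        (card L * card A + inversions B A + inversions L K)
      = (card K * card B + inversions A B + inversions K L) +
        2 * (card L * card A + inversions B A + inversions L K)"
    (is "?e + ?r = ?l + 2 * ?r'") by (simp add: algebra_simps)
  then have "(-1) ^ ?e * (-1) ^ ?r = (-1 :: complex) ^ (?l + 2 * ?r)"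
    by (metis power_add)
  then show ?thesis
    by (simp add: koszul_sign_def power_add power_mult mult.commute [of "card A"] mult.commute [of "card B"])
qed

lemma koszul_sign_empty_left [simp]: "koszul_sign {} {} B L = 1"
  by (simp add: koszul_sign_def)

lemma koszul_sign_nonzero [simp]: "koszul_sign A K B L \<noteq> 0"
  by (simp add: koszul_sign_def)

section \<open>Multiplication by Laurent polynomials\<close>

definition contributions ::
  "('n::{finite,linorder}, complex) dist_ZW \<Rightarrow> ('n, 'u::ab_group_add) dist_ZW \<Rightarrow>
    int \<Rightarrow> 'n set \<Rightarrow> int \<Rightarrow> 'n set \<Rightarrow> (int \<times> 'n set \<times> int \<times> 'n set) set" where
  "contributions p a n I m K = {(n', I', m', K'). I' \<subseteq> I \<and> K' \<subseteq> K \<and>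
     p n' I' m' K' \<noteq> 0 \<and> a (n - n') (I - I') (m - m') (K - K') \<noteq> 0}"

text \<open>A coefficient of \<open>dist_mult\<close> with infinitely many contributions silently
  becomes 0, so the algebraic laws for general factors are stated under this condition.\<close>

definition mult_defined ::
  "('n::{finite,linorder}, complex) dist_ZW \<Rightarrow> ('n, 'u::ab_group_add) dist_ZW \<Rightarrow> bool" where
  "mult_defined p a \<longleftrightarrow> (\<forall>n I m K. finite (contributions p a n I m K))"

text \<open>Integer combinations of monomials. Differences as the only closure rule give sums and
  negatives, and leave just two cases in each induction.\<close>

inductive laurent_poly :: "('n, complex) dist_ZW \<Rightarrow> bool" where
  monomial: "laurent_poly (monomial_ZW n I m K)"
| diff: "laurent_poly p \<Longrightarrow> laurent_poly q \<Longrightarrow> laurent_poly (p - q)"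

text \<open>The induction rule provided by the package has the difference in \<open>\<eta>\<close>-expanded form.\<close>

lemma laurent_poly_induct [consumes 1, case_names monomial diff]:
  assumes "laurent_poly p"
    and "\<And>n I m K. P (monomial_ZW n I m K)"
    and "\<And>p q. laurent_poly p \<Longrightarrow> P p \<Longrightarrow> laurent_poly q \<Longrightarrow> P q \<Longrightarrow> P (p - q)"
  shows "P p"
  using assms(1)
proof induction
  case (diff p q)
  then show ?case
    using assms(3) [of p q] by (simp add: fun_diff_def)
qed (rule assms(2))

lemma laurent_poly_zero: "laurent_poly 0"
  using laurent_poly.diff [OF laurent_poly.monomial laurent_poly.monomial]
  by (metis diff_self)

lemma laurent_poly_add:
  assumes "laurent_poly p" "laurent_poly q"
  shows "laurent_poly (p + q)"
proof -
  have "laurent_poly (p - (0 - q))"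
    by (intro laurent_poly.diff laurent_poly_zero assms)
  then show ?thesis
    by simp
qed

lemma laurent_poly_sum: "(\<And>x. x \<in> S \<Longrightarrow> laurent_poly (f x)) \<Longrightarrow> laurent_poly (sum f S)"
  by (induction S rule: infinite_finite_induct) (simp_all add: laurent_poly_zero laurent_poly_add)

lemma contributions_diff_left:
  "contributions (p - q) a n I m K \<subseteq> contributions p a n I m K \<union> contributions q a n I m K"
  by (auto simp: contributions_def dist_apply)

lemma contributions_diff_right:
  "contributions p (a - b) n I m K \<subseteq> contributions p a n I m K \<union> contributions p b n I m K"
  by (auto simp: contributions_def dist_apply)

lemma mult_defined_diff_left:
  "mult_defined p a \<Longrightarrow> mult_defined q a \<Longrightarrow> mult_defined (p - q) a"
  unfolding mult_defined_def
  by (meson contributions_diff_left finite_UnI finite_subset)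

lemma mult_defined_monomial: "mult_defined (monomial_ZW n0 I0 m0 K0) a"
proof -
  have "contributions (monomial_ZW n0 I0 m0 K0) a n I m K \<subseteq> {(n0, I0, m0, K0)}" for n I m K
    by (auto simp: contributions_def monomial_ZW_def split: if_splits)
  then show ?thesis
    unfolding mult_defined_def by (meson finite.emptyI finite.insertI finite_subset)
qed

lemma mult_defined_laurent_poly: "laurent_poly p \<Longrightarrow> mult_defined p a"
  by (induction rule: laurent_poly_induct) (simp_all add: mult_defined_monomial mult_defined_diff_left)

text \<open>One locale serves both the coefficient space \<open>'u\<close> and, through the
  interpretation \<open>complex_scale\<close>, the scalar distributions, so each law is proved
  once.\<close>

locale complex_vector_space = vector_space scale
  for scale :: "complex \<Rightarrow> 'u::ab_group_add \<Rightarrow> 'u"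
begin

text \<open>Any finite superset of the contributions may serve as index set, because a further index
  inside the allowed range has a vanishing factor. Several products can thus be compared over one
  set.\<close>

lemma dist_mult_eq_sum:
  assumes "finite S" "contributions p a n I m K \<subseteq> S"
    and "\<And>n' I' m' K'. (n', I', m', K') \<in> S \<Longrightarrow> I' \<subseteq> I \<and> K' \<subseteq> K"
  shows "dist_mult scale p a n I m K = (\<Sum>(n', I', m', K')\<in>S.
    scale (koszul_sign I' K' (I - I') (K - K') * p n' I' m' K')
      (a (n - n') (I - I') (m - m') (K - K')))"
  unfolding dist_mult_def contributions_def [symmetric]
proof (intro sum.mono_neutral_left ballI)
  fix x
  assume "x \<in> S - contributions p a n I m K"
  then show "(case x of (n', I', m', K') \<Rightarrow>
      scale (koszul_sign I' K' (I - I') (K - K') * p n' I' m' K')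
        (a (n - n') (I - I') (m - m') (K - K'))) = 0"
    using assms(3) by (cases x) (fastforce simp: contributions_def)
qed (use assms in auto)

lemma dist_mult_diff_left:
  assumes "mult_defined p a" "mult_defined q a"
  shows "dist_mult scale (p - q) a = dist_mult scale p a - dist_mult scale q a"
proof (intro ext)
  fix n I m K
  let ?S = "contributions p a n I m K \<union> contributions q a n I m K"
  have "finite ?S"
    using assms by (simp add: mult_defined_def)
  moreover have "I' \<subseteq> I \<and> K' \<subseteq> K" if "(n', I', m', K') \<in> ?S" for n' I' m' K'
    using that by (auto simp: contributions_def)
  ultimately have "dist_mult scale (p - q) a n I m K =
      dist_mult scale p a n I m K - dist_mult scale q a n I m K"
    using contributions_diff_left [of p q a n I m K]
    by (simp only: dist_mult_eq_sum [of ?S] sum_subtractf [symmetric] le_sup_iff Un_upper1 Un_upper2)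
      (simp add: split_def algebra_simps dist_apply)
  then show "dist_mult scale (p - q) a n I m K
      = (dist_mult scale p a - dist_mult scale q a) n I m K"
    by (simp only: minus_apply)
qed

lemma dist_mult_diff_right:
  assumes "mult_defined p a" "mult_defined p b"
  shows "dist_mult scale p (a - b) = dist_mult scale p a - dist_mult scale p b"
proof (intro ext)
  fix n I m K
  let ?S = "contributions p a n I m K \<union> contributions p b n I m K"
  have "finite ?S"
    using assms by (simp add: mult_defined_def)
  moreover have "I' \<subseteq> I \<and> K' \<subseteq> K" if "(n', I', m', K') \<in> ?S" for n' I' m' K'
    using that by (auto simp: contributions_def)
  ultimately have "dist_mult scale p (a - b) n I m K =
      dist_mult scale p a n I m K - dist_mult scale p b n I m K"
    using contributions_diff_right [of p a b n I m K]
    by (simp only: dist_mult_eq_sum [of ?S] sum_subtractf [symmetric] le_sup_iff Un_upper1 Un_upper2)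
      (simp add: split_def algebra_simps dist_apply)
  then show "dist_mult scale p (a - b) n I m K
      = (dist_mult scale p a - dist_mult scale p b) n I m K"
    by (simp only: minus_apply)
qed

lemma dist_mult_monomial:
  "dist_mult scale (monomial_ZW n0 I0 m0 K0) a n I m K =
    (if I0 \<subseteq> I \<and> K0 \<subseteq> K
     then scale (koszul_sign I0 K0 (I - I0) (K - K0)) (a (n - n0) (I - I0) (m - m0) (K - K0))
     else 0)"
proof -
  let ?S = "if I0 \<subseteq> I \<and> K0 \<subseteq> K then {(n0, I0, m0, K0)} else {}"
  have "contributions (monomial_ZW n0 I0 m0 K0) a n I m K \<subseteq> ?S"
    by (auto simp: contributions_def monomial_ZW_def split: if_splits)
  moreover have "finite ?S"
    by simp
  moreover have "I' \<subseteq> I \<and> K' \<subseteq> K" if "(n', I', m', K') \<in> ?S" for n' I' m' K'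
    using that by (auto split: if_splits)
  ultimately have "dist_mult scale (monomial_ZW n0 I0 m0 K0) a n I m K =
      (\<Sum>(n', I', m', K')\<in>?S. scale (koszul_sign I' K' (I - I') (K - K') *
        monomial_ZW n0 I0 m0 K0 n' I' m' K') (a (n - n') (I - I') (m - m') (K - K')))"
    by (intro dist_mult_eq_sum)
  then show ?thesis
    by (simp add: monomial_ZW_def)
qed

end

interpretation complex_scale: complex_vector_space "(*) :: complex \<Rightarrow> complex \<Rightarrow> complex"
  by unfold_locales (auto simp: algebra_simps)

context complex_vector_space
begin

text \<open>Multiplying by the monomial \<open>s\<close> translates indices: \<open>shift\<close>
  and \<open>unshift\<close> are inverse bijections between the contributions to \<open>q\<close>
  times \<open>a\<close> and those to \<open>s\<close> times \<open>q\<close> times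
  \<open>a\<close>. This transfers finiteness, and it matches the sums once the signs agree.\<close>

lemma
  fixes q :: "('n::{finite,linorder}, complex) dist_ZW" and a :: "('n, 'u) dist_ZW"
    and n0 m0 :: int and I0 K0 :: "'n set"
  defines "s \<equiv> monomial_ZW n0 I0 m0 K0"
  shows mult_defined_monomial_mult:
      "mult_defined q a \<Longrightarrow> mult_defined (dist_mult (*) s q) a"
    and dist_mult_assoc_monomial:
      "dist_mult scale (dist_mult (*) s q) a = dist_mult scale s (dist_mult scale q a)"
proof -
  define shift where
    "shift = (\<lambda>(n' :: int, I', m' :: int, K'). (n' + n0, I' \<union> I0, m' + m0, K' \<union> K0))"
  define unshift where
    "unshift = (\<lambda>(n' :: int, I', m' :: int, K'). (n' - n0, I' - I0, m' - m0, K' - K0))"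
  have sq: "dist_mult (*) s q n I m K = (if I0 \<subseteq> I \<and> K0 \<subseteq> K
      then koszul_sign I0 K0 (I - I0) (K - K0) * q (n - n0) (I - I0) (m - m0) (K - K0) else 0)"
    for n I m K
    unfolding s_def by (rule complex_scale.dist_mult_monomial)
  have empty: "contributions (dist_mult (*) s q) a n I m K = {}" if "\<not> (I0 \<subseteq> I \<and> K0 \<subseteq> K)"
    for n I m K
    using that by (auto simp: contributions_def sq split: if_splits)
  have to_prod: "shift x \<in> contributions (dist_mult (*) s q) a n I m K" "unshift (shift x) = x"
    if "x \<in> contributions q a (n - n0) (I - I0) (m - m0) (K - K0)" "I0 \<subseteq> I" "K0 \<subseteq> K"
    for x n I m K
  proof -
    obtain n' I' m' K' where x: "x = (n', I', m', K')"
      using prod_cases4 by blast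
    have "I' \<union> I0 - I0 = I'" "K' \<union> K0 - K0 = K'" "I - (I' \<union> I0) = I - I0 - I'"
      "K - (K' \<union> K0) = K - K0 - K'"
      using that by (auto simp: x contributions_def)
    then show "shift x \<in> contributions (dist_mult (*) s q) a n I m K" "unshift (shift x) = x"
      using that by (auto simp: x shift_def unshift_def contributions_def sq diff_diff_eq add.commute)
  qed
  have from_prod: "unshift x \<in> contributions q a (n - n0) (I - I0) (m - m0) (K - K0)"
      "shift (unshift x) = x" "I0 \<subseteq> I \<and> K0 \<subseteq> K"
    if "x \<in> contributions (dist_mult (*) s q) a n I m K" for x n I m K
  proof -
    obtain n' I' m' K' where x: "x = (n', I', m', K')"
      using prod_cases4 by blast
    have sub: "I0 \<subseteq> I'" "K0 \<subseteq> K'" "I' \<subseteq> I" "K' \<subseteq> K"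
      using that by (auto simp: x contributions_def sq split: if_splits)
    then have "I' - I0 \<union> I0 = I'" "K' - K0 \<union> K0 = K'" "I - I0 - (I' - I0) = I - I'"
      "K - K0 - (K' - K0) = K - K'"
      by auto
    then show "unshift x \<in> contributions q a (n - n0) (I - I0) (m - m0) (K - K0)"
      "shift (unshift x) = x" "I0 \<subseteq> I \<and> K0 \<subseteq> K"
      using that sub by (auto simp: x shift_def unshift_def contributions_def sq)
  qed
  show "mult_defined (dist_mult (*) s q) a" if "mult_defined q a"
    unfolding mult_defined_def
  proof (intro allI)
    fix n I m K
    have "contributions (dist_mult (*) s q) a n I m K \<subseteq>
        shift ` contributions q a (n - n0) (I - I0) (m - m0) (K - K0)"
      by (metis from_prod(1,2) image_eqI subsetI)
    then show "finite (contributions (dist_mult (*) s q) a n I m K)"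
      using that by (meson finite_imageI finite_subset mult_defined_def)
  qed
  show "dist_mult scale (dist_mult (*) s q) a = dist_mult scale s (dist_mult scale q a)"
  proof (intro ext)
    fix n I m K
    show "dist_mult scale (dist_mult (*) s q) a n I m K =
        dist_mult scale s (dist_mult scale q a) n I m K"
    proof (cases "I0 \<subseteq> I \<and> K0 \<subseteq> K")
      case False
      have *: "dist_mult scale (dist_mult (*) s q) a n I m K = 0"
        unfolding dist_mult_def [of _ "dist_mult _ s q"] contributions_def [symmetric] empty [OF False]
        by simp
      show ?thesis
        unfolding * unfolding s_def dist_mult_monomial using False by auto
    next
      case True
      show ?thesis
        unfolding s_def dist_mult_monomial
        unfolding s_def [symmetric] dist_mult_def [of scale] contributions_def [symmetric]
          if_P [OF True] scale_sum_right
      proof (rule sum.reindex_bij_witness [of _ shift unshift])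
        fix x
        assume x: "x \<in> contributions (dist_mult (*) s q) a n I m K"
        show "shift (unshift x) = x"
          "unshift x \<in> contributions q a (n - n0) (I - I0) (m - m0) (K - K0)"
          using from_prod [OF x] by auto
        obtain n' I' m' K' where x': "x = (n', I', m', K')"
          using prod_cases4 by blast
        have sub: "I0 \<subseteq> I'" "K0 \<subseteq> K'" "I' \<subseteq> I" "K' \<subseteq> K"
          using x by (auto simp: x' contributions_def sq split: if_splits)
        have unions: "I0 \<union> (I' - I0) = I'" "K0 \<union> (K' - K0) = K'"
          "(I' - I0) \<union> (I - I') = I - I0" "(K' - K0) \<union> (K - K') = K - K0"
          "I - I0 - (I' - I0) = I - I'" "K - K0 - (K' - K0) = K - K'"
          using sub by auto
        \<comment> \<open>The cocycle identity for the three disjoint blocks coming from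
          \<open>s\<close>, from \<open>q\<close> and from \<open>a\<close>.\<close>
        have "koszul_sign I0 K0 (I' - I0) (K' - K0) *
              koszul_sign (I0 \<union> (I' - I0)) (K0 \<union> (K' - K0)) (I - I') (K - K') =
            koszul_sign I0 K0 ((I' - I0) \<union> (I - I')) ((K' - K0) \<union> (K - K')) *
              koszul_sign (I' - I0) (K' - K0) (I - I') (K - K')"
          using sub by (intro koszul_sign_cocycle) auto
        then have "koszul_sign I0 K0 (I - I0) (K - K0) * koszul_sign (I' - I0) (K' - K0) (I - I') (K - K') =
            koszul_sign I' K' (I - I') (K - K') * koszul_sign I0 K0 (I' - I0) (K' - K0)"
          unfolding unions by (simp add: mult.commute)
        then show "scale (koszul_sign I0 K0 (I - I0) (K - K0)) (case unshift x of (n', I', m', K') \<Rightarrow>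
            scale (koszul_sign I' K' (I - I0 - I') (K - K0 - K') * q n' I' m' K')
             (a (n - n0 - n') (I - I0 - I') (m - m0 - m') (K - K0 - K'))) =
          (case x of (n', I', m', K') \<Rightarrow>
            scale (koszul_sign I' K' (I - I') (K - K') * dist_mult (*) s q n' I' m' K')
             (a (n - n') (I - I') (m - m') (K - K')))"
          using sub by (simp add: x' unshift_def sq unions)
      next
        fix x
        assume x: "x \<in> contributions q a (n - n0) (I - I0) (m - m0) (K - K0)"
        show "unshift (shift x) = x" "shift x \<in> contributions (dist_mult (*) s q) a n I m K"
          using to_prod [OF x] True by auto
      qed
    qed
  qed
qed

text \<open>Both claims go through one induction: splitting the product of a difference with
  \<open>q\<close> requires that the two partial products with \<open>a\<close> are already defined.
  The factor \<open>q\<close> may be an infinite series such as a derivative of delta.\<close>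

lemma
  fixes q :: "('n::{finite,linorder}, complex) dist_ZW" and a :: "('n, 'u) dist_ZW"
  assumes "laurent_poly p" "mult_defined q a"
  shows mult_defined_mult: "mult_defined (dist_mult (*) p q) a"
    and dist_mult_assoc: "dist_mult scale (dist_mult (*) p q) a = dist_mult scale p (dist_mult scale q a)"
proof -
  have "mult_defined (dist_mult (*) p q) a \<and>
      dist_mult scale (dist_mult (*) p q) a = dist_mult scale p (dist_mult scale q a)"
    using assms(1)
  proof (induction rule: laurent_poly_induct)
    case (monomial n I m K)
    then show ?case
      by (simp add: mult_defined_monomial_mult dist_mult_assoc_monomial assms)
  next
    case (diff p r)
    then show ?case
      by (simp add: complex_scale.dist_mult_diff_left dist_mult_diff_left
          mult_defined_diff_left mult_defined_laurent_poly)
  qed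
  then show "mult_defined (dist_mult (*) p q) a"
    "dist_mult scale (dist_mult (*) p q) a = dist_mult scale p (dist_mult scale q a)"
    by auto
qed

section \<open>Additivity of the product in each factor\<close>

lemma dist_mult_zero_left [simp]: "dist_mult scale 0 a = 0"
  by (intro ext) (simp add: dist_mult_def dist_apply)

lemma dist_mult_zero_right [simp]: "dist_mult scale p 0 = 0"
  by (intro ext) (simp add: dist_mult_def dist_apply)

lemma dist_mult_diff:
  "laurent_poly p \<Longrightarrow> dist_mult scale p (a - b) = dist_mult scale p a - dist_mult scale p b"
  by (intro dist_mult_diff_right mult_defined_laurent_poly)

lemma dist_mult_minus: "laurent_poly p \<Longrightarrow> dist_mult scale p (- a) = - dist_mult scale p a"
  using dist_mult_diff [of p 0 a] by simp

lemma dist_mult_add: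
  "laurent_poly p \<Longrightarrow> dist_mult scale p (a + b) = dist_mult scale p a + dist_mult scale p b"
  using dist_mult_diff [of p a "- b"] by (simp add: dist_mult_minus)

lemma dist_mult_sum:
  "laurent_poly p \<Longrightarrow> dist_mult scale p (sum f S) = (\<Sum>x\<in>S. dist_mult scale p (f x))"
  by (induction S rule: infinite_finite_induct) (simp_all add: dist_mult_add)

lemma poly_diff_mult:
  assumes "laurent_poly p" "laurent_poly q"
  shows "dist_mult scale (p - q) a = dist_mult scale p a - dist_mult scale q a"
  using assms by (intro dist_mult_diff_left mult_defined_laurent_poly)

lemma poly_add_mult:
  assumes "laurent_poly p" "laurent_poly q"
  shows "dist_mult scale (p + q) a = dist_mult scale p a + dist_mult scale q a"
proof -
  have "dist_mult scale (p - (0 - q)) a = dist_mult scale p a - dist_mult scale (0 - q) a"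
    by (intro poly_diff_mult laurent_poly.diff laurent_poly_zero assms)
  also have "dist_mult scale (0 - q) a = dist_mult scale 0 a - dist_mult scale q a"
    by (intro poly_diff_mult laurent_poly_zero assms)
  finally show ?thesis
    by simp
qed

lemma poly_sum_mult:
  "(\<And>x. x \<in> S \<Longrightarrow> laurent_poly (f x)) \<Longrightarrow>
    dist_mult scale (sum f S) a = (\<Sum>x\<in>S. dist_mult scale (f x) a)"
  by (induction S rule: infinite_finite_induct) (simp_all add: poly_add_mult laurent_poly_sum)

lemma dist_mult_one [simp]: "dist_mult scale one_ZW a = a"
  by (intro ext) (simp add: dist_mult_monomial)

section \<open>Supercommutativity of multiplication operators\<close>

lemma dist_mult_monomial_monomial:
  "dist_mult scale (monomial_ZW n0 I0 m0 K0) (dist_mult scale (monomial_ZW n1 I1 m1 K1) a) n I m K =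
    (if I0 \<inter> I1 = {} \<and> K0 \<inter> K1 = {} \<and> I0 \<union> I1 \<subseteq> I \<and> K0 \<union> K1 \<subseteq> K
     then scale (koszul_sign I0 K0 I1 K1 *
         koszul_sign (I0 \<union> I1) (K0 \<union> K1) (I - (I0 \<union> I1)) (K - (K0 \<union> K1)))
       (a (n - (n0 + n1)) (I - (I0 \<union> I1)) (m - (m0 + m1)) (K - (K0 \<union> K1)))
     else 0)" (is "_ = (if ?c then _ else 0)")
proof (cases ?c)
  case True
  then have "I1 \<subseteq> I - I0" "K1 \<subseteq> K - K0" "I - I0 - I1 = I - (I0 \<union> I1)"
    "K - K0 - K1 = K - (K0 \<union> K1)" "I1 \<union> (I - (I0 \<union> I1)) = I - I0"
    "K1 \<union> (K - (K0 \<union> K1)) = K - K0"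
    by auto
  moreover from True have "koszul_sign I0 K0 I1 K1 *
      koszul_sign (I0 \<union> I1) (K0 \<union> K1) (I - (I0 \<union> I1)) (K - (K0 \<union> K1)) =
    koszul_sign I0 K0 (I1 \<union> (I - (I0 \<union> I1))) (K1 \<union> (K - (K0 \<union> K1))) *
      koszul_sign I1 K1 (I - (I0 \<union> I1)) (K - (K0 \<union> K1))"
    by (intro koszul_sign_cocycle) auto
  ultimately show ?thesis
    using True by (simp add: dist_mult_monomial diff_diff_eq)
next
  case False
  then have "\<not> (I0 \<subseteq> I \<and> K0 \<subseteq> K \<and> I1 \<subseteq> I - I0 \<and> K1 \<subseteq> K - K0)"
    by auto
  then show ?thesis
    unfolding if_not_P [OF False] by (auto simp: dist_mult_monomial)
qed

text \<open>In \<open>dist_mult_monomial_monomial\<close> everything but the first sign is symmetric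
  in the two monomials, and \<open>koszul_sign_commute\<close> exchanges that sign.\<close>

lemma dist_mult_monomial_commute:
  "dist_mult scale (monomial_ZW n0 I0 m0 K0) (dist_mult scale (monomial_ZW n1 I1 m1 K1) a) n I m K =
    scale ((-1) ^ ((card I0 + card K0) * (card I1 + card K1)))
     (dist_mult scale (monomial_ZW n1 I1 m1 K1) (dist_mult scale (monomial_ZW n0 I0 m0 K0) a) n I m K)"
proof (cases "I0 \<inter> I1 = {} \<and> K0 \<inter> K1 = {}")
  case True
  then show ?thesis
    unfolding dist_mult_monomial_monomial koszul_sign_commute [OF conjunct1 conjunct2, OF True True]
      Un_commute [of I1 I0] Un_commute [of K1 K0] Int_commute [of I1 I0] Int_commute [of K1 K0]
      add.commute [of n1 n0] add.commute [of m1 m0]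
    by (simp only: mult.assoc scale_scale scale_zero_right if_distrib [of "scale _"])
next
  case False
  then show ?thesis
    unfolding dist_mult_monomial_monomial Int_commute [of I1 I0] Int_commute [of K1 K0]
    by auto
qed

lemma even_monomial_commute:
  assumes "laurent_poly p" "even (card I0 + card K0)"
  shows "dist_mult scale (monomial_ZW n0 I0 m0 K0) (dist_mult scale p a) =
    dist_mult scale p (dist_mult scale (monomial_ZW n0 I0 m0 K0) a)"
  using assms(1)
proof (induction rule: laurent_poly_induct)
  case (monomial n I m K)
  have "(-1) ^ ((card I0 + card K0) * (card I + card K)) = (1 :: complex)"
    using assms(2) by simp
  then show ?case
    by (intro ext) (subst dist_mult_monomial_commute, simp only: scale_one)
next
  case (diff p q)
  then show ?case
    by (simp add: poly_diff_mult dist_mult_diff laurent_poly.monomial)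
qed

lemma odd_monomials_anticommute:
  assumes "odd (card I0 + card K0)" "odd (card I1 + card K1)"
  shows "dist_mult scale (monomial_ZW n0 I0 m0 K0) (dist_mult scale (monomial_ZW n1 I1 m1 K1) a) =
    - dist_mult scale (monomial_ZW n1 I1 m1 K1) (dist_mult scale (monomial_ZW n0 I0 m0 K0) a)"
proof -
  have "(-1) ^ ((card I0 + card K0) * (card I1 + card K1)) = (-1 :: complex)"
    using assms by simp
  then show ?thesis
    by (intro ext, subst dist_mult_monomial_commute)
      (simp only: scale_minus_left scale_one uminus_apply)
qed

text \<open>Division by 2 in the ground field. It turns anticommutation of an odd operator with
  itself into a vanishing square.\<close>

lemma eq_minus_imp_zero: "a = 0" if "a = - a" for a :: "('n, 'u) dist_ZW"
proof (intro ext)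
  fix n I m K
  have "a n I m K = - a n I m K"
    using arg_cong [OF that, of "\<lambda>f. f n I m K"] by (simp only: uminus_apply)
  then have "a n I m K + a n I m K = 0"
    by (metis add.left_inverse)
  moreover have "scale 2 (a n I m K) = a n I m K + a n I m K"
    using scale_left_distrib [of 1 1 "a n I m K"] by simp
  ultimately show "a n I m K = 0 n I m K"
    unfolding zero_fun_apply by (metis scale_eq_0_iff zero_neq_numeral)
qed

end

lemma koszul_sign_cases: "koszul_sign A K B L = 1 \<or> koszul_sign A K B L = - 1"
  by (auto simp: koszul_sign_def minus_one_power_iff)

text \<open>A product of two monomials is zero, a monomial or minus a monomial; the last is written
  \<open>0 - ?s\<close> to fit the generating rules.\<close>

lemma laurent_poly_mult:
  assumes "laurent_poly p" "laurent_poly q"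
  shows "laurent_poly (dist_mult (*) p q)"
  using assms(1)
proof (induction rule: laurent_poly_induct)
  case (monomial n I m K)
  show ?case
    using assms(2)
  proof (induction rule: laurent_poly_induct)
    case (monomial n' I' m' K')
    let ?s = "monomial_ZW (n + n') (I \<union> I') (m + m') (K \<union> K')"
    have "dist_mult (*) (monomial_ZW n I m K) (monomial_ZW n' I' m' K') =
        (if I \<inter> I' = {} \<and> K \<inter> K' = {} then
          if koszul_sign I K I' K' = 1 then ?s else 0 - ?s else 0)"
    proof (intro ext)
      fix a A b B
      let ?c = "I \<subseteq> A \<and> K \<subseteq> B \<and> a - n = n' \<and> A - I = I' \<and> b - m = m' \<and> B - K = K'"
      have c: "?c \<longleftrightarrow> I \<inter> I' = {} \<and> K \<inter> K' = {} \<and>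
          (a = n + n' \<and> A = I \<union> I' \<and> b = m + m' \<and> B = K \<union> K')"
        by auto
      have "dist_mult (*) (monomial_ZW n I m K) (monomial_ZW n' I' m' K') a A b B =
          (if ?c then koszul_sign I K (A - I) (B - K) else 0)"
        unfolding complex_scale.dist_mult_monomial monomial_ZW_def [of n' I' m' K'] by simp
      also have "\<dots> = (if ?c then koszul_sign I K I' K' else 0)"
        by (intro if_cong refl) simp
      also have "\<dots> = (if I \<inter> I' = {} \<and> K \<inter> K' = {} then koszul_sign I K I' K' * ?s a A b B else 0)"
        unfolding c monomial_ZW_def by simp
      finally have "dist_mult (*) (monomial_ZW n I m K) (monomial_ZW n' I' m' K') a A b B =
          (if I \<inter> I' = {} \<and> K \<inter> K' = {} then koszul_sign I K I' K' * ?s a A b B else 0)" .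
      then show "dist_mult (*) (monomial_ZW n I m K) (monomial_ZW n' I' m' K') a A b B =
          (if I \<inter> I' = {} \<and> K \<inter> K' = {} then
            if koszul_sign I K I' K' = 1 then ?s else 0 - ?s else 0) a A b B"
        using koszul_sign_cases [of I K I' K'] by (auto simp: dist_apply)
    qed
    moreover have "laurent_poly ?s" "laurent_poly (0 - ?s)" "laurent_poly (0 :: ('a, complex) dist_ZW)"
      by (intro laurent_poly.diff laurent_poly_zero laurent_poly.monomial)+
    ultimately show ?case
      by presburger
  next
    case (diff p q)
    then show ?case
      by (simp add: complex_scale.dist_mult_diff laurent_poly.intros)
  qed
next
  case (diff p q)
  then show ?case
    by (simp add: complex_scale.poly_diff_mult laurent_poly.diff assms(2))
qed

lemma var_\<theta>_mult_var_\<zeta>: "dist_mult (*) (var_\<theta> i) (var_\<zeta> i) = monomial_ZW 0 {i} 0 {i}"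
proof (intro ext)
  fix n I m K
  show "dist_mult (*) (var_\<theta> i) (var_\<zeta> i) n I m K = monomial_ZW 0 {i} 0 {i} n I m K"
    unfolding complex_scale.dist_mult_monomial monomial_ZW_def [of 0 "{}" 0 "{i}"]
      monomial_ZW_def [of 0 "{i}" 0 "{i}"]
    by (auto simp: koszul_sign_def)
qed

section \<open>Distributions with vanishing moments\<close>

definition odd_diff :: "'n \<Rightarrow> ('n, complex) dist_ZW" where
  "odd_diff i = var_\<theta> i - var_\<zeta> i"

text \<open>Interpolates between \<open>z - w\<close> at \<open>S = {}\<close> and the even part of
  \<open>Z - W\<close> at \<open>S = UNIV\<close>, so that the nilpotent terms can be added one at a
  time.\<close>

definition even_diff :: "'n::{finite,linorder} set \<Rightarrow> ('n, complex) dist_ZW" where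
  "even_diff S = var_z - var_w - (\<Sum>i\<in>S. monomial_ZW 0 {i} 0 {i})"

abbreviation super_diff :: "('n::{finite,linorder}, complex) dist_ZW" where
  "super_diff \<equiv> even_diff UNIV"

lemma laurent_poly_odd_diff: "laurent_poly (odd_diff i)"
  unfolding odd_diff_def by (intro laurent_poly.intros)

lemma laurent_poly_even_diff: "laurent_poly (even_diff S)"
  unfolding even_diff_def by (intro laurent_poly.intros laurent_poly_sum)

lemma even_diff_empty: "even_diff {} = var_z - var_w"
  by (simp add: even_diff_def)

lemma even_diff_insert: "i \<notin> S \<Longrightarrow> even_diff (insert i S) = even_diff S - monomial_ZW 0 {i} 0 {i}"
  by (simp add: even_diff_def)

lemma laurent_poly_dist_power: "laurent_poly p \<Longrightarrow> laurent_poly (dist_power p k)"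
  by (induction k) (simp_all add: dist_power_def laurent_poly.monomial laurent_poly_mult)

text \<open>Multiplication by a power of \<open>Z - W\<close> is handled as a composite of
  operators, so that commutation relations apply factor by factor.\<close>

abbreviation odd_mults where
  "odd_mults scale l \<equiv> foldr (\<lambda>i. dist_mult scale (odd_diff i)) l"

abbreviation super_mults where
  "super_mults scale j \<equiv> dist_mult scale super_diff ^^ j"

lemma odd_diff_prod_eq: "odd_diff_prod J = odd_mults (*) (sorted_list_of_set J) one_ZW"
  by (simp add: odd_diff_prod_def odd_diff_def)

lemma laurent_poly_odd_mults: "laurent_poly p \<Longrightarrow> laurent_poly (odd_mults (*) l p)"
  by (induction l) (simp_all add: laurent_poly_odd_diff laurent_poly_mult)

lemma laurent_poly_odd_diff_prod: "laurent_poly (odd_diff_prod J)"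
  by (simp add: odd_diff_prod_eq laurent_poly_odd_mults laurent_poly.monomial)

text \<open>Locality refers to multiplication by \<open>z - w\<close>, the coefficient formula to multiplication by
  \<open>z - w - \<Sum> \<theta>\<^sup>i \<zeta>\<^sup>i\<close>; the two operators differ by commuting operators of square zero.\<close>

lemma nilpotent_perturbation:
  fixes A T :: "'a::ab_group_add \<Rightarrow> 'a"
  assumes A: "\<And>x y. A (x - y) = A x - A y" and T: "\<And>x y. T (x - y) = T x - T y"
    and commute: "\<And>x. A (T x) = T (A x)" and square: "\<And>x. T (T x) = 0"
    and "(A ^^ k) a = 0"
  shows "((\<lambda>x. A x - T x) ^^ Suc k) a = 0"
  using assms(5)
proof (induction k arbitrary: a)
  case 0
  then show ?case
    using A [of 0 0] T [of 0 0] by simp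
next
  case (Suc k)
  let ?B = "\<lambda>x. A x - T x"
  \<comment> \<open>The kernel of \<open>T\<close> is stable under \<open>A\<close>, and on it the
    perturbation has no effect.\<close>
  have B: "(?B ^^ j) x = (A ^^ j) x" if "T x = 0" for j x
    using that
  proof (induction j arbitrary: x)
    case (Suc j)
    have "T (A x) = 0"
      using Suc.prems commute [of x] A [of 0 0] by simp
    then show ?case
      using Suc by (simp add: funpow_Suc_right del: funpow.simps)
  qed simp
  have B_diff: "(?B ^^ j) (x - y) = (?B ^^ j) x - (?B ^^ j) y" for j x y
  proof (induction j)
    case (Suc j)
    show ?case
      by (simp only: funpow.simps o_apply Suc A T) (simp add: algebra_simps)
  qed simp
  have AT: "(A ^^ j) (T x) = T ((A ^^ j) x)" for j x
    by (induction j) (simp_all add: commute)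
  \<comment> \<open>Peel off one factor: \<open>A a\<close> falls under the induction hypothesis,
    while \<open>T a\<close> lies in the kernel of \<open>T\<close> because \<open>T\<close> squares
    to zero.\<close>
  have "(?B ^^ Suc (Suc k)) a = (?B ^^ Suc k) (A a - T a)"
    by (simp only: funpow_Suc_right o_apply)
  also have "\<dots> = (?B ^^ Suc k) (A a) - (A ^^ Suc k) (T a)"
    by (simp only: B_diff B square)
  also have "(?B ^^ Suc k) (A a) = 0"
    using Suc.prems by (intro Suc.IH) (simp only: funpow_Suc_right o_apply)
  also have "(A ^^ Suc k) (T a) = 0"
    using Suc.prems T [of 0 0] by (simp only: AT) simp
  finally show ?case
    by simp
qed

lemma res_Z_diff: "res_Z (a - b) = res_Z a - res_Z (b :: ('n, 'u::ab_group_add) dist_ZW)"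
  by (intro ext) (simp add: res_Z_def dist_apply)

lemma res_Z_zero [simp]: "res_Z 0 = 0"
  by (intro ext) (simp add: res_Z_def dist_apply)

lemma res_Z_minus: "res_Z (- a) = - res_Z (a :: ('n, 'u::ab_group_add) dist_ZW)"
  using res_Z_diff [of 0 a] by simp

context complex_vector_space
begin

section \<open>Multiplication by powers of Z - W as a composite of operators\<close>

lemma dist_power_mult:
  "laurent_poly p \<Longrightarrow> dist_mult scale (dist_power p k) a = (dist_mult scale p ^^ k) a"
proof (induction k)
  case 0
  then show ?case
    by (simp add: dist_power_def)
next
  case (Suc k)
  then have "dist_mult scale (dist_mult (*) p (dist_power p k)) a =
      dist_mult scale p (dist_mult scale (dist_power p k) a)"
    by (intro dist_mult_assoc mult_defined_laurent_poly laurent_poly_dist_power)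
  then show ?case
    using Suc by (simp add: dist_power_def)
qed

lemma odd_mults_mult:
  assumes "mult_defined p a"
  shows "dist_mult scale (odd_mults (*) l p) a = odd_mults scale l (dist_mult scale p a)"
    and "mult_defined (odd_mults (*) l p) a"
proof -
  have "dist_mult scale (odd_mults (*) l p) a = odd_mults scale l (dist_mult scale p a) \<and>
      mult_defined (odd_mults (*) l p) a"
    using assms
    by (induction l) (simp_all add: dist_mult_assoc mult_defined_mult laurent_poly_odd_diff)
  then show "dist_mult scale (odd_mults (*) l p) a = odd_mults scale l (dist_mult scale p a)"
    "mult_defined (odd_mults (*) l p) a"
    by auto
qed

lemma super_mults_mult:
  assumes "mult_defined p a"
  shows "dist_mult scale (super_mults (*) j p) a = super_mults scale j (dist_mult scale p a)"
proof -
  have "dist_mult scale (super_mults (*) j p) a = super_mults scale j (dist_mult scale p a) \<and>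
      mult_defined (super_mults (*) j p) a"
    using assms
    by (induction j) (simp_all add: dist_mult_assoc mult_defined_mult laurent_poly_even_diff)
  then show ?thesis
    by auto
qed

lemma odd_diff_prod_mult:
  "dist_mult scale (odd_diff_prod J) a = odd_mults scale (sorted_list_of_set J) a"
  by (simp add: odd_diff_prod_eq odd_mults_mult mult_defined_monomial)

lemma ZW_diff_power_mult:
  "dist_mult scale (ZW_diff_power j J) a =
    super_mults scale j (odd_mults scale (sorted_list_of_set J) a)"
proof -
  have "dist_mult scale (ZW_diff_power j J) a =
      dist_mult scale (dist_mult (*) (dist_power super_diff j) (odd_diff_prod J)) a"
    by (simp add: ZW_diff_power_def even_diff_def var_\<theta>_mult_var_\<zeta>)
  also have "\<dots> = dist_mult scale (dist_power super_diff j) (dist_mult scale (odd_diff_prod J) a)"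
    by (intro dist_mult_assoc mult_defined_laurent_poly laurent_poly_dist_power
        laurent_poly_even_diff laurent_poly_odd_diff_prod)
  finally show ?thesis
    by (simp only: dist_power_mult laurent_poly_even_diff odd_diff_prod_mult)
qed

lemma odd_diff_mult:
  "dist_mult scale (odd_diff i) a = dist_mult scale (var_\<theta> i) a - dist_mult scale (var_\<zeta> i) a"
  unfolding odd_diff_def by (intro poly_diff_mult laurent_poly.monomial)

lemma even_diff_mult:
  "dist_mult scale (even_diff S) a = dist_mult scale var_z a - dist_mult scale var_w a -
    (\<Sum>i\<in>S. dist_mult scale (monomial_ZW 0 {i} 0 {i}) a)"
  unfolding even_diff_def
  by (simp only: poly_diff_mult poly_sum_mult laurent_poly.intros laurent_poly_sum)

text \<open>All monomials of \<open>even_diff S\<close> have even parity.\<close>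

lemma even_diff_commute:
  "laurent_poly p \<Longrightarrow>
    dist_mult scale (even_diff S) (dist_mult scale p a) = dist_mult scale p (dist_mult scale (even_diff S) a)"
  unfolding even_diff_mult
  by (simp only: dist_mult_diff dist_mult_sum) (simp add: even_monomial_commute)

lemma odd_monomial_odd_diff_anticommute:
  assumes "odd (card I + card K)"
  shows "dist_mult scale (odd_diff i) (dist_mult scale (monomial_ZW n I m K) a) =
    - dist_mult scale (monomial_ZW n I m K) (dist_mult scale (odd_diff i) a)"
proof -
  have "dist_mult scale (var_\<theta> i) (dist_mult scale (monomial_ZW n I m K) a) =
      - dist_mult scale (monomial_ZW n I m K) (dist_mult scale (var_\<theta> i) a)"
    "dist_mult scale (var_\<zeta> i) (dist_mult scale (monomial_ZW n I m K) a) =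
      - dist_mult scale (monomial_ZW n I m K) (dist_mult scale (var_\<zeta> i) a)"
    by (rule odd_monomials_anticommute; use assms in simp)+
  then show ?thesis
    by (simp add: odd_diff_mult dist_mult_diff laurent_poly.monomial)
qed

lemma odd_diff_anticommute:
  "dist_mult scale (odd_diff i) (dist_mult scale (odd_diff j) a) =
    - dist_mult scale (odd_diff j) (dist_mult scale (odd_diff i) a)"
  by (simp add: odd_diff_mult [of j] dist_mult_diff laurent_poly_odd_diff
      odd_monomial_odd_diff_anticommute)

lemma odd_diff_square [simp]: "dist_mult scale (odd_diff i) (dist_mult scale (odd_diff i) a) = 0"
  by (intro eq_minus_imp_zero odd_diff_anticommute)

text \<open>The sign depends on the parity of \<open>length l\<close>. It is left open, since the
  vanishing of a residue is insensitive to it.\<close>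

lemma odd_mults_anticommute:
  assumes "laurent_poly p"
    and "\<And>i b. i \<in> set l \<Longrightarrow> dist_mult scale (odd_diff i) (dist_mult scale p b) =
      - dist_mult scale p (dist_mult scale (odd_diff i) b)"
  shows "odd_mults scale l (dist_mult scale p a) = dist_mult scale p (odd_mults scale l a) \<or>
    odd_mults scale l (dist_mult scale p a) = - dist_mult scale p (odd_mults scale l a)"
  using assms(2)
proof (induction l)
  case (Cons i l)
  then show ?case
    by (auto simp: dist_mult_minus laurent_poly_odd_diff)
qed simp

text \<open>Anticommutation moves the new factor next to its copy in \<open>l\<close>, where the
  square vanishes.\<close>

lemma odd_diff_odd_mults_zero:
  "i \<in> set l \<Longrightarrow> dist_mult scale (odd_diff i) (odd_mults scale l a) = 0"
proof (induction l)
  case (Cons j l)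
  then show ?case
    by (cases "i = j") (simp_all add: odd_diff_anticommute [of i])
qed simp

text \<open>Restores the increasing order in which the moments are formed.\<close>

lemma odd_mults_insort:
  "dist_mult scale (odd_diff i) (odd_mults scale l a) = odd_mults scale (insort i l) a \<or>
    dist_mult scale (odd_diff i) (odd_mults scale l a) = - odd_mults scale (insort i l) a"
proof (induction l)
  case (Cons j l)
  have "dist_mult scale (odd_diff i) (dist_mult scale (odd_diff j) (odd_mults scale l a)) =
      - dist_mult scale (odd_diff j) (dist_mult scale (odd_diff i) (odd_mults scale l a))"
    by (rule odd_diff_anticommute)
  then show ?case
    using Cons by (auto simp: dist_mult_minus laurent_poly_odd_diff)
qed simp

lemma odd_mults_diff: "odd_mults scale l (a - b) = odd_mults scale l a - odd_mults scale l b"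
  by (induction l) (simp_all add: dist_mult_diff laurent_poly_odd_diff)

lemma super_mults_diff: "super_mults scale j (a - b) = super_mults scale j a - super_mults scale j b"
  by (induction j) (simp_all add: dist_mult_diff laurent_poly_even_diff)

lemma super_mults_minus: "super_mults scale j (- a) = - super_mults scale j a"
  by (induction j) (simp_all add: dist_mult_minus laurent_poly_even_diff)

lemma super_mults_zero: "super_mults scale j 0 = 0"
  by (induction j) simp_all

lemma odd_mults_zero: "odd_mults scale j 0 = 0"
  by (induction j) simp_all

lemma super_mults_commute:
  "laurent_poly p \<Longrightarrow>
    super_mults scale j (dist_mult scale p a) = dist_mult scale p (super_mults scale j a)"
  by (induction j) (simp_all add: even_diff_commute)

lemma odd_mults_even_diff:
  "odd_mults scale l (dist_mult scale (even_diff S) a) = dist_mult scale (even_diff S) (odd_mults scale l a)"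
  by (induction l) (simp_all add: even_diff_commute laurent_poly_odd_diff)

lemma super_mults_odd_mults:
  "super_mults scale j (odd_mults scale l a) = odd_mults scale l (super_mults scale j a)"
  by (induction l) (simp_all add: super_mults_commute laurent_poly_odd_diff)

text \<open>By \<open>ZW_diff_power_mult\<close> these residues are the coefficients that the
  theorem asserts.\<close>

definition moments_vanish :: "('n::{finite,linorder}, 'u) dist_ZW \<Rightarrow> bool" where
  "moments_vanish a \<longleftrightarrow> (\<forall>j J.
    res_Z (super_mults scale j (odd_mults scale (sorted_list_of_set J) a)) = 0)"

section \<open>Operators preserving the vanishing of moments\<close>

lemma moments_vanish_diff: "moments_vanish a \<Longrightarrow> moments_vanish b \<Longrightarrow> moments_vanish (a - b)"
  by (simp add: moments_vanish_def super_mults_diff odd_mults_diff res_Z_diff)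

lemma moments_vanish_zero: "moments_vanish 0"
  by (simp add: moments_vanish_def super_mults_zero odd_mults_zero)

lemma moments_vanish_add:
  assumes "moments_vanish a" "moments_vanish b"
  shows "moments_vanish (a + b)"
proof -
  have "moments_vanish (a - (0 - b))"
    by (intro moments_vanish_diff moments_vanish_zero assms)
  then show ?thesis
    by simp
qed

lemma moments_vanish_sum: "(\<And>x. x \<in> S \<Longrightarrow> moments_vanish (f x)) \<Longrightarrow> moments_vanish (sum f S)"
  by (induction S rule: infinite_finite_induct)
    (simp_all add: moments_vanish_zero moments_vanish_add)

lemma moments_vanish_super_diff: "moments_vanish a \<Longrightarrow> moments_vanish (dist_mult scale super_diff a)"
  unfolding moments_vanish_def odd_mults_even_diff
  by (metis funpow_Suc_right o_apply)

text \<open>Up to sign, the moment at \<open>J\<close> of the product is the moment of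
  \<open>a\<close> at \<open>insert i J\<close>, or zero if \<open>i\<close> already occurs in
  \<open>J\<close>.\<close>

lemma moments_vanish_odd_diff:
  assumes "moments_vanish a"
  shows "moments_vanish (dist_mult scale (odd_diff i) a)"
  unfolding moments_vanish_def
proof (intro allI)
  fix j :: nat and J :: "'a set"
  let ?l = "sorted_list_of_set J"
  let ?b = "super_mults scale j (dist_mult scale (odd_diff i) (odd_mults scale ?l a))"
  have "res_Z ?b = 0"
  proof (cases "i \<in> J")
    case True
    then show ?thesis
      by (simp add: odd_diff_odd_mults_zero super_mults_zero)
  next
    case False
    then have insort: "insort i ?l = sorted_list_of_set (insert i J)"
      by simp
    show ?thesis
      using odd_mults_insort [of i ?l a] assms unfolding insort
      by (auto simp: moments_vanish_def super_mults_minus res_Z_minus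
          simp del: sorted_list_of_set_insert_remove)
  qed
  then show "res_Z (super_mults scale j (odd_mults scale ?l (dist_mult scale (odd_diff i) a))) = 0"
    using odd_mults_anticommute [OF laurent_poly_odd_diff odd_diff_anticommute, of ?l i a]
    by (auto simp: super_mults_minus res_Z_minus)
qed

lemma res_Z_var_\<zeta>_mult: "res_Z a = 0 \<Longrightarrow> res_Z (dist_mult scale (var_\<zeta> i) a) = 0"
  by (simp add: res_Z_def fun_eq_iff dist_mult_monomial dist_apply)

text \<open>Up to sign, the variable can be pulled out of all factors of the moment, and
  \<open>res_Z\<close> does not see multiplication by variables of \<open>W\<close>.\<close>

lemma moments_vanish_var_\<zeta>:
  assumes "moments_vanish a"
  shows "moments_vanish (dist_mult scale (var_\<zeta> i) a)"
  unfolding moments_vanish_def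
proof (intro allI)
  fix j :: nat and J :: "'a set"
  let ?l = "sorted_list_of_set J"
  have "res_Z (super_mults scale j (dist_mult scale (var_\<zeta> i) (odd_mults scale ?l a))) = 0"
    using assms
    by (simp add: super_mults_commute laurent_poly.monomial res_Z_var_\<zeta>_mult moments_vanish_def)
  moreover have "odd_mults scale ?l (dist_mult scale (var_\<zeta> i) a) =
        dist_mult scale (var_\<zeta> i) (odd_mults scale ?l a) \<or>
      odd_mults scale ?l (dist_mult scale (var_\<zeta> i) a) =
        - dist_mult scale (var_\<zeta> i) (odd_mults scale ?l a)"
    by (rule odd_mults_anticommute)
      (simp_all add: laurent_poly.monomial odd_monomial_odd_diff_anticommute)
  ultimately show "res_Z (super_mults scale j (odd_mults scale ?l (dist_mult scale (var_\<zeta> i) a))) = 0"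
    by (auto simp: super_mults_minus res_Z_minus)
qed

lemma moments_vanish_var_\<theta>:
  "moments_vanish a \<Longrightarrow> moments_vanish (dist_mult scale (var_\<theta> i) a)"
  using moments_vanish_add [OF moments_vanish_odd_diff [of a i] moments_vanish_var_\<zeta> [of a i]]
  by (simp add: odd_diff_mult)

lemma moments_vanish_z_minus_w:
  assumes "moments_vanish a"
  shows "moments_vanish (dist_mult scale (even_diff {}) a)"
proof -
  have "dist_mult scale (monomial_ZW 0 {i} 0 {i}) a =
      dist_mult scale (var_\<theta> i) (dist_mult scale (var_\<zeta> i) a)" for i :: 'a
    by (simp add: dist_mult_assoc_monomial flip: var_\<theta>_mult_var_\<zeta>)
  then have "dist_mult scale (even_diff {}) a = dist_mult scale super_diff a +
      (\<Sum>i\<in>UNIV. dist_mult scale (var_\<theta> i) (dist_mult scale (var_\<zeta> i) a))"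
    by (simp add: even_diff_mult)
  then show ?thesis
    using assms
    by (simp add: moments_vanish_add moments_vanish_sum moments_vanish_super_diff
        moments_vanish_var_\<theta> moments_vanish_var_\<zeta>)
qed

text \<open>Induction on the number of odd variables missing from \<open>I\<close>. Multiplying by a
  missing one moves the coefficient at \<open>I\<close>, up to sign, to \<open>insert i I\<close>
  and keeps the moments zero.\<close>

lemma moments_vanish_imp_coeff_zero:
  fixes a :: "('n::{finite,linorder}, 'u) dist_ZW"
  assumes "moments_vanish a"
  shows "a (-1) I m K = 0"
  using assms
proof (induction "card (- I)" arbitrary: I a)
  case 0
  \<comment> \<open>For \<open>I = UNIV\<close> the coefficient is the moment with
    \<open>j = 0\<close> and \<open>J = {}\<close>, which is \<open>res_Z a\<close> itself.\<close>
  then have "res_Z (super_mults scale 0 (odd_mults scale (sorted_list_of_set {}) a)) m K = 0 m K"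
    unfolding moments_vanish_def by metis
  moreover have "I = UNIV"
    using 0(1) by auto
  ultimately show ?case
    by (simp add: res_Z_def dist_apply)
next
  case (Suc c)
  then obtain i where i: "i \<notin> I"
    by (metis ComplD card.empty ex_in_conv nat.distinct(1))
  have "- insert i I = - I - {i}"
    by auto
  then have "c = card (- insert i I)"
    using Suc.hyps(2) i by simp
  then have "dist_mult scale (var_\<theta> i) a (-1) (insert i I) m K = 0"
    by (rule Suc.hyps(1)) (rule moments_vanish_var_\<theta> [OF Suc.prems])
  then show ?case
    using i by (simp add: dist_mult_monomial)
qed

lemma moments_vanish_imp_zero:
  fixes a :: "('n::{finite,linorder}, 'u) dist_ZW"
  assumes "moments_vanish a" "dist_mult scale (even_diff {}) a = 0"
  shows "a = 0"
proof -
  have shift: "a (n - 1) I m K = a n I (m - 1) K" for n I m K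
    using arg_cong [OF assms(2), of "\<lambda>f. f n I m K"]
    by (simp add: even_diff_mult dist_mult_monomial dist_apply)
  \<comment> \<open>The coefficients are constant along each line \<open>n + m = s\<close>, and
    every such line meets \<open>n = -1\<close>; the induction runs from there in both
    directions.\<close>
  have "a n I (s - n) K = a (-1) I (s + 1) K" for n I s K
  proof (induction n rule: int_induct [where k = "-1"])
    case (step1 n)
    then show ?case
      using shift [of "n + 1" I "s - n" K] by (simp only: add_diff_cancel_right' diff_diff_eq)
  next
    case (step2 n)
    then show ?case
      using shift [of n I "s - (n - 1)" K] by (simp only: diff_diff_eq diff_add_cancel)
  qed simp
  then have "a n I m K = 0" for n I m K
    using moments_vanish_imp_coeff_zero [OF assms(1)] by (metis add_diff_cancel_right')
  then show ?thesis
    by (intro ext) (simp add: dist_apply)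
qed

lemma moments_vanish_local_imp_zero:
  "moments_vanish a \<Longrightarrow> (dist_mult scale (even_diff {}) ^^ k) a = 0 \<Longrightarrow> a = 0"
proof (induction k arbitrary: a)
  case (Suc k)
  have "(dist_mult scale (even_diff {}) ^^ k) (dist_mult scale (even_diff {}) a) = 0"
    using Suc.prems(2) by (simp only: funpow_Suc_right o_apply)
  then have "dist_mult scale (even_diff {}) a = 0"
    by (rule Suc.IH [OF moments_vanish_z_minus_w [OF Suc.prems(1)]])
  with Suc.prems(1) show ?case
    by (rule moments_vanish_imp_zero)
qed simp

text \<open>Adding \<open>i\<close> to \<open>S\<close> subtracts an operator of square zero that
  commutes with \<open>even_diff S\<close>, so \<open>nilpotent_perturbation\<close>
  applies.\<close>

lemma even_diff_nilpotent_iff: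
  fixes a :: "('n::{finite,linorder}, 'u) dist_ZW"
  shows "(\<exists>k. (dist_mult scale (even_diff S) ^^ k) a = 0) \<longleftrightarrow>
    (\<exists>k. (dist_mult scale (even_diff {}) ^^ k) a = 0)"
  using finite [of S]
proof (induction S)
  case (insert i S)
  let ?t = "monomial_ZW 0 {i} 0 {i} :: ('n, complex) dist_ZW"
  have square: "dist_mult scale ?t (dist_mult scale ?t b) = 0" for b
    by (intro ext) (simp add: dist_mult_monomial_monomial dist_apply)
  have *: "dist_mult scale (even_diff (insert i S)) =
      (\<lambda>b. dist_mult scale (even_diff S) b - dist_mult scale ?t b)"
    using insert.hyps
    by (intro ext) (simp add: even_diff_insert poly_diff_mult laurent_poly_even_diff laurent_poly.monomial)
  \<comment> \<open>The converse direction subtracts the negative of the same operator.\<close>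
  then have **: "dist_mult scale (even_diff S) =
      (\<lambda>b. dist_mult scale (even_diff (insert i S)) b - - dist_mult scale ?t b)"
    by simp
  have "(\<exists>k. (dist_mult scale (even_diff (insert i S)) ^^ k) a = 0) \<longleftrightarrow>
      (\<exists>k. (dist_mult scale (even_diff S) ^^ k) a = 0)"
  proof safe
    fix k
    assume "(dist_mult scale (even_diff (insert i S)) ^^ k) a = 0"
    then have "(dist_mult scale (even_diff S) ^^ Suc k) a = 0"
      by (subst **, intro nilpotent_perturbation)
        (simp_all add: dist_mult_diff dist_mult_minus laurent_poly_even_diff laurent_poly.monomial
          even_diff_commute square)
    then show "\<exists>k. (dist_mult scale (even_diff S) ^^ k) a = 0" ..
  next
    fix k
    assume "(dist_mult scale (even_diff S) ^^ k) a = 0"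
    then have "(dist_mult scale (even_diff (insert i S)) ^^ Suc k) a = 0"
      by (subst *, intro nilpotent_perturbation)
        (simp_all add: dist_mult_diff laurent_poly_even_diff laurent_poly.monomial
          even_diff_commute square)
    then show "\<exists>k. (dist_mult scale (even_diff (insert i S)) ^^ k) a = 0" ..
  qed
  then show ?case
    using insert.IH by simp
qed simp

text \<open>Locality expressed by the operator from which the moments are built.\<close>

lemma local_dist_iff: "local_dist scale a \<longleftrightarrow> (\<exists>k. super_mults scale k a = 0)"
  unfolding local_dist_def even_diff_empty [symmetric]
  by (simp only: dist_power_mult laurent_poly_even_diff even_diff_nilpotent_iff [of UNIV])

end

section \<open>Commutation relations of the derivations\<close>

lemma dist_mult_var_\<theta>:
  "dist_mult (*) (var_\<theta> i) a n I m K =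
    (if i \<in> I then (-1) ^ card {k \<in> I. k < i} * a n (I - {i}) m K else 0)"
proof -
  have "{k \<in> I - {i}. k < i} = {k \<in> I. k < i}"
    by auto
  then show ?thesis
    by (simp add: complex_scale.dist_mult_monomial koszul_sign_def inversions_singleton)
qed

lemma dist_mult_var_\<zeta>:
  "dist_mult (*) (var_\<zeta> i) a n I m K =
    (if i \<in> K then (-1) ^ (card I + card {k \<in> K. k < i}) * a n I m (K - {i}) else 0)"
proof -
  have "{k \<in> K - {i}. k < i} = {k \<in> K. k < i}"
    by auto
  then show ?thesis
    by (simp add: complex_scale.dist_mult_monomial koszul_sign_def inversions_singleton)
qed

lemma dist_mult_var_z: "dist_mult (*) var_z a n I m K = a (n - 1) I m K"
  and dist_mult_var_w: "dist_mult (*) var_w a n I m K = a n I (m - 1) K"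
  by (simp_all add: complex_scale.dist_mult_monomial)

definition scale_ZW :: "complex \<Rightarrow> ('n, complex) dist_ZW \<Rightarrow> ('n, complex) dist_ZW" where
  "scale_ZW c a = (\<lambda>n I m K. c * a n I m K)"

lemma scale_ZW_zero [simp]: "scale_ZW c 0 = 0" "scale_ZW 0 a = 0"
  by (intro ext; simp add: scale_ZW_def dist_apply)+

lemma scale_ZW_one [simp]: "scale_ZW 1 a = a"
  by (simp add: scale_ZW_def)

lemma scale_ZW_add: "scale_ZW c a + scale_ZW d a = scale_ZW (c + d) a"
  by (intro ext) (simp add: scale_ZW_def dist_apply algebra_simps)

lemma dist_mult_scale_ZW:
  "laurent_poly p \<Longrightarrow> dist_mult (*) p (scale_ZW c a) = scale_ZW c (dist_mult (*) p a)"
proof (induction rule: laurent_poly_induct)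
  case (monomial n I m K)
  show ?case
    by (intro ext) (simp add: complex_scale.dist_mult_monomial scale_ZW_def)
next
  case (diff p q)
  then have "dist_mult (*) (p - q) (scale_ZW c a) =
      scale_ZW c (dist_mult (*) p a) - scale_ZW c (dist_mult (*) q a)"
    by (simp add: complex_scale.poly_diff_mult)
  also have "\<dots> = scale_ZW c (dist_mult (*) p a - dist_mult (*) q a)"
    by (intro ext) (simp add: scale_ZW_def dist_apply algebra_simps)
  also have "dist_mult (*) p a - dist_mult (*) q a = dist_mult (*) (p - q) a"
    using diff by (simp add: complex_scale.poly_diff_mult)
  finally show ?case .
qed

lemma super_mults_scale_ZW: "super_mults (*) j (scale_ZW c a) = scale_ZW c (super_mults (*) j a)"
  by (induction j) (simp_all add: dist_mult_scale_ZW laurent_poly_even_diff)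

lemma odd_mults_scale_ZW: "odd_mults (*) l (scale_ZW c a) = scale_ZW c (odd_mults (*) l a)"
  by (induction l) (simp_all add: dist_mult_scale_ZW laurent_poly_odd_diff)

lemma deriv_w_scale_ZW: "deriv_w (scale_ZW c a) = scale_ZW c (deriv_w a)"
  by (intro ext) (simp add: scale_ZW_def deriv_w_def)

lemma deriv_w_diff: "deriv_w (a - b) = deriv_w a - deriv_w b"
  by (intro ext) (simp add: deriv_w_def dist_apply algebra_simps)

lemma deriv_w_zero [simp]: "deriv_w 0 = 0"
  by (intro ext) (simp add: deriv_w_def dist_apply)

lemma deriv_w_minus: "deriv_w (- a) = - deriv_w a"
  using deriv_w_diff [of 0 a] by simp

lemma deriv_w_sum: "deriv_w (sum f S) = (\<Sum>x\<in>S. deriv_w (f x))"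
proof (induction S rule: infinite_finite_induct)
  case (insert x S)
  then show ?case
    using deriv_w_diff [of "f x" "- sum f S"] by (simp add: deriv_w_minus)
qed simp_all

lemma deriv_\<zeta>_diff: "deriv_\<zeta> i (a - b) = deriv_\<zeta> i a - deriv_\<zeta> i b"
  by (intro ext) (simp add: deriv_\<zeta>_def dist_apply algebra_simps)

lemma deriv_\<zeta>_zero [simp]: "deriv_\<zeta> i 0 = 0"
  by (intro ext) (simp add: deriv_\<zeta>_def dist_apply)

lemma deriv_\<zeta>_minus: "deriv_\<zeta> i (- a) = - deriv_\<zeta> i a"
  using deriv_\<zeta>_diff [of i 0 a] by simp

lemma deriv_\<zeta>_sum: "deriv_\<zeta> i (sum f S) = (\<Sum>x\<in>S. deriv_\<zeta> i (f x))"
proof (induction S rule: infinite_finite_induct)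
  case (insert x S)
  then show ?case
    using deriv_\<zeta>_diff [of i "f x" "- sum f S"] by (simp add: deriv_\<zeta>_minus)
qed simp_all

lemma deriv_w_monomial_0:
  "deriv_w (dist_mult (*) (monomial_ZW n I 0 K) a) = dist_mult (*) (monomial_ZW n I 0 K) (deriv_w a)"
  by (intro ext) (simp add: deriv_w_def complex_scale.dist_mult_monomial)

lemma deriv_w_var_w: "deriv_w (dist_mult (*) var_w a) = a + dist_mult (*) var_w (deriv_w a)"
  by (intro ext) (simp add: deriv_w_def dist_mult_var_w dist_apply algebra_simps)

lemma deriv_w_odd_diff: "deriv_w (dist_mult (*) (odd_diff i) a) = dist_mult (*) (odd_diff i) (deriv_w a)"
  by (simp add: complex_scale.odd_diff_mult deriv_w_diff deriv_w_monomial_0)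

lemma deriv_w_even_diff:
  "deriv_w (dist_mult (*) (even_diff S) a) = dist_mult (*) (even_diff S) (deriv_w a) - a"
  by (simp add: complex_scale.even_diff_mult deriv_w_diff deriv_w_sum deriv_w_monomial_0 deriv_w_var_w)

lemma deriv_w_power_odd_mults:
  "odd_mults (*) l ((deriv_w ^^ n) a) = (deriv_w ^^ n) (odd_mults (*) l a)"
proof -
  have *: "dist_mult (*) (odd_diff i) ((deriv_w ^^ n) b) = (deriv_w ^^ n) (dist_mult (*) (odd_diff i) b)" for i b
    by (induction n) (simp_all flip: deriv_w_odd_diff)
  show ?thesis
    by (induction l) (simp_all add: *)
qed

lemma deriv_\<zeta>_var_z: "deriv_\<zeta> i (dist_mult (*) var_z a) = dist_mult (*) var_z (deriv_\<zeta> i a)"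
  and deriv_\<zeta>_var_w: "deriv_\<zeta> i (dist_mult (*) var_w a) = dist_mult (*) var_w (deriv_\<zeta> i a)"
  by (intro ext; simp add: deriv_\<zeta>_def dist_mult_var_z dist_mult_var_w)+

lemma deriv_\<zeta>_var_\<theta>:
  "deriv_\<zeta> i (dist_mult (*) (var_\<theta> j) a) = - dist_mult (*) (var_\<theta> j) (deriv_\<zeta> i a)"
proof (intro ext)
  fix n I m K
  \<comment> \<open>Removing \<open>j\<close> lowers the \<open>card I\<close> in the sign of
    \<open>deriv_\<zeta>\<close> by one, which is the source of the minus sign.\<close>
  have "\<exists>c. card I = Suc c" if "j \<in> I"
    using that by (metis card.remove finite)
  then show "deriv_\<zeta> i (dist_mult (*) (var_\<theta> j) a) n I m K =
      (- dist_mult (*) (var_\<theta> j) (deriv_\<zeta> i a)) n I m K"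
    unfolding uminus_apply dist_mult_var_\<theta> deriv_\<zeta>_def by (auto split: if_splits)
qed

text \<open>The canonical anticommutation relation. For \<open>i = j\<close>, exactly one of the two
  products survives at each \<open>K\<close>, and its two equal signs cancel.\<close>

lemma deriv_\<zeta>_var_\<zeta>:
  "deriv_\<zeta> i (dist_mult (*) (var_\<zeta> j) a) =
    (if i = j then a else 0) - dist_mult (*) (var_\<zeta> j) (deriv_\<zeta> i a)"
proof (cases "i = j")
  case True
  have sets: "{k. (k = i \<or> k \<in> K) \<and> k < i} = {k \<in> K. k < i}" "{k \<in> K. k \<noteq> i \<and> k < i} = {k \<in> K. k < i}" "{k \<in> insert i K. k < i} = {k \<in> K. k < i}" "{k \<in> K - {i}. k < i} = {k \<in> K. k < i}" for K
    by auto
  have square: "(-1) ^ e * ((-1) ^ e * x) = x" for e and x :: complex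
    by (simp add: minus_one_power_iff)
  have "deriv_\<zeta> i (dist_mult (*) (var_\<zeta> i) a) n I m K =
      a n I m K - dist_mult (*) (var_\<zeta> i) (deriv_\<zeta> i a) n I m K" for n I m K
  proof (cases "i \<in> K")
    case True
    then show ?thesis
      by (simp add: dist_mult_var_\<zeta> deriv_\<zeta>_def sets square insert_absorb)
  next
    case False
    then show ?thesis
      by (simp add: dist_mult_var_\<zeta> deriv_\<zeta>_def sets square)
  qed
  then show ?thesis
    using True by (intro ext) (simp add: minus_apply)
next
  case False
  have 1: "card {k \<in> insert i K. k < j} = card {k \<in> K. k < j} + (if i < j then 1 else 0)"
    if "i \<notin> K" for K
  proof -
    have "{k \<in> insert i K. k < j} = (if i < j then insert i {k \<in> K. k < j} else {k \<in> K. k < j})"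
      by auto
    then show ?thesis
      using that by simp
  qed
  have 2: "card {k \<in> K. k < i} = card {k \<in> K - {j}. k < i} + (if j < i then 1 else 0)"
    if "j \<in> K" for K
  proof -
    have "{k \<in> K. k < i} = (if j < i then insert j {k \<in> K - {j}. k < i} else {k \<in> K - {j}. k < i})"
      using that by auto
    then show ?thesis
      by simp
  qed
  have "deriv_\<zeta> i (dist_mult (*) (var_\<zeta> j) a) n I m K =
      - dist_mult (*) (var_\<zeta> j) (deriv_\<zeta> i a) n I m K" for n I m K
  proof (cases "i \<notin> K \<and> j \<in> K")
    case True
    have "insert i K - {j} = insert i (K - {j})"
      using False by auto
    moreover have "i \<notin> K" "j \<in> K" "j \<in> insert i K" "i \<notin> K - {j}"
      using True by auto
    \<comment> \<open>Only the count below the larger of the two indices changes in \<open>1\<close>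
      and \<open>2\<close>, which leaves a single sign.\<close>
    moreover have "i < j \<and> \<not> j < i \<or> j < i \<and> \<not> i < j"
      using False by auto
    ultimately show ?thesis
      unfolding dist_mult_var_\<zeta> deriv_\<zeta>_def
      by (elim disjE conjE)
        (simp_all only: 1 2 simp_thms if_True if_False power_add power_one_right power_0 add_0_right
          mult_minus_left mult_minus_right mult_1 mult_1_right minus_minus mult_ac)
  next
    case not_both: False
    then show ?thesis
      using False by (auto simp: dist_mult_var_\<zeta> deriv_\<zeta>_def)
  qed
  then show ?thesis
    using False by (intro ext) (simp add: dist_apply)
qed

section \<open>Relations between D_W and the differences\<close>

lemma D_W_diff: "D_W i (a - b) = D_W i a - D_W i b"
  by (simp add: D_W_def deriv_\<zeta>_diff deriv_w_diff complex_scale.dist_mult_diff laurent_poly.monomial)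

lemma D_W_zero [simp]: "D_W i 0 = 0"
  by (simp add: D_W_def)

lemma D_W_minus: "D_W i (- a) = - D_W i a"
  using D_W_diff [of i 0 a] by simp

text \<open>The summand of \<open>D_W i\<close> with \<open>deriv_w\<close> anticommutes with
  \<open>odd_diff j\<close>; the extra term comes from differentiating
  \<open>- var_\<zeta> j\<close>.\<close>

lemma D_W_odd_diff:
  "D_W i (dist_mult (*) (odd_diff j) a) =
    - dist_mult (*) (odd_diff j) (D_W i a) - (if i = j then a else 0)"
proof -
  have "dist_mult (*) (var_\<zeta> i) (dist_mult (*) (odd_diff j) b) =
      - dist_mult (*) (odd_diff j) (dist_mult (*) (var_\<zeta> i) b)" for b
    by (simp add: complex_scale.odd_monomial_odd_diff_anticommute)
  then show ?thesis
    unfolding D_W_def deriv_w_odd_diff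
    by (simp add: complex_scale.dist_mult_add laurent_poly_odd_diff)
      (simp add: complex_scale.odd_diff_mult deriv_\<zeta>_diff deriv_\<zeta>_var_\<theta> deriv_\<zeta>_var_\<zeta>)
qed

lemma odd_diff_D_W:
  "dist_mult (*) (odd_diff j) (D_W i a) =
    - D_W i (dist_mult (*) (odd_diff j) a) - (if i = j then a else 0)"
  unfolding D_W_odd_diff by simp

lemma \<theta>_\<zeta>_mult:
  "dist_mult (*) (monomial_ZW 0 {i} 0 {i}) a = dist_mult (*) (var_\<theta> i) (dist_mult (*) (var_\<zeta> i) a)"
  by (simp add: complex_scale.dist_mult_assoc_monomial flip: var_\<theta>_mult_var_\<zeta>)

text \<open>The left zeta derivative of the nilpotent sum contributes \<open>var_\<theta> i\<close>,
  and the w derivative of \<open>- w\<close> contributes \<open>- var_\<zeta> i\<close>.\<close>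

lemma D_W_super_diff:
  "D_W i (dist_mult (*) super_diff a) = dist_mult (*) super_diff (D_W i a) + dist_mult (*) (odd_diff i) a"
proof -
  let ?t = "\<lambda>j. dist_mult (*) (monomial_ZW 0 {j} 0 {j})"
  have t: "deriv_\<zeta> i (?t j a) = ?t j (deriv_\<zeta> i a) - (if j = i then dist_mult (*) (var_\<theta> i) a else 0)" for j
    by (simp add: \<theta>_\<zeta>_mult deriv_\<zeta>_var_\<theta> deriv_\<zeta>_var_\<zeta> complex_scale.dist_mult_diff
        complex_scale.dist_mult_minus laurent_poly.monomial)
  have "deriv_\<zeta> i (dist_mult (*) super_diff a) =
      dist_mult (*) super_diff (deriv_\<zeta> i a) + dist_mult (*) (var_\<theta> i) a"
    by (simp add: complex_scale.even_diff_mult deriv_\<zeta>_diff deriv_\<zeta>_sum t deriv_\<zeta>_var_z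
        deriv_\<zeta>_var_w sum_subtractf sum.delta)
  then show ?thesis
    unfolding D_W_def deriv_w_even_diff
    by (simp add: complex_scale.dist_mult_add complex_scale.dist_mult_diff laurent_poly_even_diff
        laurent_poly.monomial complex_scale.even_diff_commute complex_scale.odd_diff_mult)
qed

abbreviation D_Ws :: "'n::{finite,linorder} list \<Rightarrow> ('n, complex) dist_ZW \<Rightarrow> ('n, complex) dist_ZW" where
  "D_Ws \<equiv> foldr D_W"

lemma odd_diff_D_Ws:
  "i \<notin> set l \<Longrightarrow> dist_mult (*) (odd_diff i) (D_Ws l b) =
    (uminus ^^ length l) (D_Ws l (dist_mult (*) (odd_diff i) b))"
proof (induction l)
  case (Cons j l)
  have "D_W j ((uminus ^^ k) c) = (uminus ^^ k) (D_W j c)" for k c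
    by (induction k) (simp_all add: D_W_minus)
  moreover have "dist_mult (*) (odd_diff i) (D_W j c) = - D_W j (dist_mult (*) (odd_diff i) c)" for c
    using odd_diff_D_W [of i j c] Cons.prems by auto
  ultimately show ?case
    using Cons by simp
qed simp

lemma uminus_power_eq: "(uminus ^^ k) a = scale_ZW ((-1) ^ k) a"
proof (induction k)
  case (Suc k)
  then show ?case
    by (intro ext) (simp add: scale_ZW_def dist_apply)
qed simp

section \<open>Derivatives of a distribution annihilated by all odd differences\<close>

context
  fixes b :: "('n::{finite,linorder}, complex) dist_ZW"
  assumes odd_diff_zero: "\<And>i. dist_mult (*) (odd_diff i) b = 0"
begin

lemma D_Ws_zero: "D_Ws l 0 = 0"
  by (induction l) simp_all

lemma odd_diff_D_Ws_notin: "i \<notin> set l \<Longrightarrow> dist_mult (*) (odd_diff i) (D_Ws l b) = 0"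
  by (simp add: odd_diff_D_Ws odd_diff_zero D_Ws_zero uminus_power_eq)

text \<open>With \<open>b\<close> as vacuum, \<open>D_W i\<close> acts as a creation operator and
  \<open>odd_diff i\<close> as the matching annihilation operator.\<close>

lemma odd_diff_D_Ws_in:
  assumes "distinct l" "i \<in> set l"
  shows "dist_mult (*) (odd_diff i) (D_Ws l b) = D_Ws (remove1 i l) b \<or>
    dist_mult (*) (odd_diff i) (D_Ws l b) = - D_Ws (remove1 i l) b"
  using assms
proof (induction l)
  case (Cons j l)
  have *: "dist_mult (*) (odd_diff i) (D_W j c) =
      - D_W j (dist_mult (*) (odd_diff i) c) - (if i = j then c else 0)" for c
    by (auto simp: odd_diff_D_W)
  show ?case
  proof (cases "i = j")
    case True
    then show ?thesis
      using Cons.prems by (simp add: odd_diff_D_W odd_diff_D_Ws_notin)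
  next
    case False
    then show ?thesis
      using Cons by (auto simp: * D_W_minus)
  qed
qed simp

text \<open>Order and sign of the remaining list are left open: for a nonempty remainder only the
  vanishing of the residue will matter.\<close>

lemma odd_mults_D_Ws:
  assumes "distinct l" "distinct l'"
  shows "if set l' \<subseteq> set l
    then \<exists>l''. distinct l'' \<and> set l'' = set l - set l' \<and>
      (odd_mults (*) l' (D_Ws l b) = D_Ws l'' b \<or> odd_mults (*) l' (D_Ws l b) = - D_Ws l'' b)
    else odd_mults (*) l' (D_Ws l b) = 0"
  using assms(2)
proof (induction l')
  case Nil
  then show ?case
    using assms(1) by auto
next
  case (Cons i l')
  show ?case
  proof (cases "set l' \<subseteq> set l")
    case True
    then obtain l'' where l'': "distinct l''" "set l'' = set l - set l'"
      "odd_mults (*) l' (D_Ws l b) = D_Ws l'' b \<or> odd_mults (*) l' (D_Ws l b) = - D_Ws l'' b"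
      using Cons by auto
    show ?thesis
    proof (cases "i \<in> set l")
      case True
      then have "i \<in> set l''"
        using l'' Cons.prems by auto
      then have "odd_mults (*) (i # l') (D_Ws l b) = D_Ws (remove1 i l'') b \<or>
          odd_mults (*) (i # l') (D_Ws l b) = - D_Ws (remove1 i l'') b"
        using l''(3) odd_diff_D_Ws_in [OF l''(1), of i]
        by (auto simp: complex_scale.dist_mult_minus laurent_poly_odd_diff)
      moreover have "distinct (remove1 i l'')" "set (remove1 i l'') = set l - set (i # l')"
        using l'' by auto
      ultimately show ?thesis
        using True \<open>set l' \<subseteq> set l\<close> by auto
    next
      case False
      then have "i \<notin> set l''"
        using l'' by auto
      then show ?thesis
        using l''(3) False odd_diff_D_Ws_notin [of i l'']
        by (auto simp: complex_scale.dist_mult_minus laurent_poly_odd_diff)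
    qed
  next
    case False
    then show ?thesis
      using Cons by auto
  qed
qed

text \<open>The last odd difference passes \<open>length l\<close> derivations and then turns
  \<open>D_W i b\<close> into \<open>- b\<close>. The exponents accumulate to a triangular number,
  the sign built into \<open>D_W_divided\<close>.\<close>

lemma odd_mults_D_Ws_same:
  assumes "distinct l"
  shows "odd_mults (*) l (D_Ws l b) = scale_ZW ((-1) ^ (length l * (length l + 1) div 2)) b"
  using assms
proof (induction l rule: rev_induct)
  case (snoc i l)
  have "dist_mult (*) (odd_diff i) (D_W i b) = - b"
    by (simp add: odd_diff_D_W odd_diff_zero)
  moreover have "D_Ws l (- c) = - D_Ws l c" for c
    by (induction l) (simp_all add: D_W_minus)
  ultimately have "odd_mults (*) (l @ [i]) (D_Ws (l @ [i]) b) =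
      odd_mults (*) l ((uminus ^^ length l) (- D_Ws l b))"
    using snoc.prems by (simp add: odd_diff_D_Ws)
  also have "(uminus ^^ length l) (- D_Ws l b) = scale_ZW ((-1) ^ Suc (length l)) (D_Ws l b)"
    by (simp only: uminus_power_eq [symmetric] funpow_Suc_right o_apply)
  also have "odd_mults (*) l \<dots> = scale_ZW ((-1) ^ Suc (length l))
      (scale_ZW ((-1) ^ (length l * (length l + 1) div 2)) b)"
    using snoc by (simp only: odd_mults_scale_ZW distinct_append)
  also have "\<dots> = scale_ZW ((-1) ^ (Suc (length l) + length l * (length l + 1) div 2)) b"
    by (simp only: scale_ZW_def power_add mult.assoc)
  also have "Suc (length l) + length l * (length l + 1) div 2 =
      length (l @ [i]) * (length (l @ [i]) + 1) div 2"
    by simp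
  finally show ?case .
qed simp

text \<open>Commuting past \<open>D_W i\<close> costs a term with \<open>odd_diff i\<close>, which
  kills the rest because \<open>l\<close> is distinct.\<close>

lemma super_diff_D_Ws:
  assumes "dist_mult (*) super_diff b = 0" "distinct l"
  shows "dist_mult (*) super_diff (D_Ws l b) = 0"
  using assms(2)
proof (induction l)
  case Nil
  then show ?case
    by (simp add: assms)
next
  case (Cons i l)
  then show ?case
    using D_W_super_diff [of i "D_Ws l b"] by (simp add: odd_diff_D_Ws_notin)
qed

end

section \<open>Residues of derivatives\<close>

definition const_W :: "complex \<Rightarrow> ('n, complex) dist_W" where
  "const_W c = (\<lambda>m K. if m = 0 \<and> K = {} then c else 0)"

lemma res_Z_scale_ZW: "res_Z a = const_W e \<Longrightarrow> res_Z (scale_ZW c a) = const_W (c * e)"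
  by (simp add: res_Z_def const_W_def scale_ZW_def fun_eq_iff)

lemma const_W_0: "const_W 0 = 0"
  by (intro ext) (simp add: const_W_def dist_apply)

lemma res_Z_deriv_w: "res_Z a = const_W e \<Longrightarrow> res_Z (deriv_w a) = const_W 0"
  by (auto simp: res_Z_def const_W_def deriv_w_def fun_eq_iff simp del: of_int_add)

lemma res_Z_deriv_w_power:
  "res_Z a = const_W e \<Longrightarrow> res_Z ((deriv_w ^^ n) a) = const_W (if n = 0 then e else 0)"
  by (induction n) (auto intro: res_Z_deriv_w)

lemma res_Z_add: "res_Z (a + b) = res_Z a + res_Z (b :: ('n, 'u::ab_group_add) dist_ZW)"
  by (intro ext) (simp add: res_Z_def dist_apply)

text \<open>Up to sign, \<open>res_Z\<close> intertwines the derivations with those in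
  \<open>W\<close> alone, and these kill constants.\<close>

lemma res_Z_D_W:
  assumes "res_Z a = const_W e"
  shows "res_Z (D_W i a) = const_W 0"
proof -
  have "res_Z (deriv_\<zeta> i a) = const_W 0"
    using assms by (simp add: res_Z_def deriv_\<zeta>_def const_W_def fun_eq_iff)
  moreover have "res_Z (dist_mult (*) (var_\<zeta> i) (deriv_w a)) = 0"
    using res_Z_deriv_w [OF assms] by (intro complex_scale.res_Z_var_\<zeta>_mult) (simp add: const_W_0)
  ultimately show ?thesis
    by (simp add: D_W_def res_Z_add)
qed

lemma res_Z_D_Ws:
  "res_Z a = const_W e \<Longrightarrow> res_Z (D_Ws l a) = const_W (if l = [] then e else 0)"
  by (induction l) (auto intro: res_Z_D_W)

text \<open>The commutator of \<open>deriv_w\<close> and \<open>super_diff\<close> is -1 by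
  \<open>deriv_w_even_diff\<close>; hence \<open>super_diff\<close> lowers powers of
  \<open>deriv_w\<close> as differentiation lowers powers of a variable.\<close>

lemma super_diff_deriv_w_power:
  assumes "dist_mult (*) super_diff v = 0"
  shows "dist_mult (*) super_diff ((deriv_w ^^ Suc n) v) = scale_ZW (of_nat (Suc n)) ((deriv_w ^^ n) v)"
proof (induction n)
  case 0
  then show ?case
    using deriv_w_even_diff [of UNIV v] assms by simp
next
  case (Suc n)
  have "dist_mult (*) super_diff ((deriv_w ^^ Suc (Suc n)) v) =
      deriv_w (dist_mult (*) super_diff ((deriv_w ^^ Suc n) v)) + (deriv_w ^^ Suc n) v"
    using deriv_w_even_diff [of UNIV "(deriv_w ^^ Suc n) v"] by simp
  also have "\<dots> = scale_ZW (of_nat (Suc n)) ((deriv_w ^^ Suc n) v) + scale_ZW 1 ((deriv_w ^^ Suc n) v)"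
    unfolding Suc by (simp add: deriv_w_scale_ZW)
  finally show ?case
    by (simp only: scale_ZW_add of_nat_Suc add.commute)
qed

lemma super_mults_deriv_w_power_zero:
  "dist_mult (*) super_diff v = 0 \<Longrightarrow> super_mults (*) (Suc n) ((deriv_w ^^ n) v) = 0"
proof (induction n)
  case (Suc n)
  have "super_mults (*) (Suc (Suc n)) ((deriv_w ^^ Suc n) v) =
      super_mults (*) (Suc n) (dist_mult (*) super_diff ((deriv_w ^^ Suc n) v))"
    by (simp only: funpow_Suc_right o_apply)
  then show ?case
    using Suc by (simp only: super_diff_deriv_w_power super_mults_scale_ZW scale_ZW_zero)
qed simp

text \<open>For \<open>j < n\<close> a derivative survives and has zero residue; for
  \<open>j > n\<close> a factor reaches \<open>v\<close> and kills it; for \<open>j = n\<close> the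
  lowering factors multiply to \<open>fact n\<close>.\<close>

lemma res_Z_super_mults_deriv_w_power:
  assumes "dist_mult (*) super_diff v = 0" "res_Z v = const_W e"
  shows "res_Z (super_mults (*) j ((deriv_w ^^ n) v)) = const_W (if j = n then fact n * e else 0)"
proof (induction j arbitrary: n)
  case 0
  then show ?case
    using res_Z_deriv_w_power [OF assms(2)] by simp
next
  case (Suc j)
  show ?case
  proof (cases n)
    case 0
    have "super_mults (*) (Suc j) v = super_mults (*) j (dist_mult (*) super_diff v)"
      by (simp only: funpow_Suc_right o_apply)
    then show ?thesis
      by (simp add: 0 assms complex_scale.super_mults_zero const_W_0 del: funpow.simps)
  next
    case n: (Suc n')
    have "super_mults (*) (Suc j) ((deriv_w ^^ n) v) =
        super_mults (*) j (dist_mult (*) super_diff ((deriv_w ^^ n) v))"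
      by (simp only: funpow_Suc_right o_apply)
    also have "\<dots> = scale_ZW (of_nat n) (super_mults (*) j ((deriv_w ^^ n') v))"
      unfolding n by (simp only: super_diff_deriv_w_power [OF assms(1)] super_mults_scale_ZW)
    finally have "res_Z (super_mults (*) (Suc j) ((deriv_w ^^ n) v)) =
        const_W (of_nat n * (if j = n' then fact n' * e else 0))"
      using res_Z_scale_ZW [OF Suc.IH [of n']] by simp
    moreover have "of_nat n * (if j = n' then fact n' * e else 0) = (if Suc j = n then fact n * e else 0)"
      by (simp add: n)
    ultimately show ?thesis
      by (simp only:)
  qed
qed

section \<open>Moments of the delta distribution\<close>

definition formal_delta :: "('n, complex) dist_ZW" where
  "formal_delta = i_zw_inverse - i_wz_inverse"

text \<open>The two expansions supply the terms with \<open>n < 0\<close> and with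
  \<open>n \<ge> 0\<close>, which join into one two-sided series.\<close>

lemma formal_delta_eq:
  "formal_delta n I m K = (if I = {} \<and> K = {} \<and> n + m = -1 then 1 else 0)"
  by (auto simp: formal_delta_def dist_apply i_zw_inverse_def i_wz_inverse_def)

lemma delta_ZW_eq: "delta_ZW = odd_mults (*) (sorted_list_of_set UNIV) formal_delta"
  by (simp add: delta_ZW_def formal_delta_def complex_scale.odd_diff_prod_mult
      complex_scale.odd_mults_diff)

lemma odd_diff_delta_ZW: "dist_mult (*) (odd_diff i) delta_ZW = 0"
  unfolding delta_ZW_eq by (intro complex_scale.odd_diff_odd_mults_zero) simp

text \<open>The factor \<open>z - w\<close> kills \<open>formal_delta\<close>. On
  \<open>delta_ZW\<close> each zeta acts as the theta of the same index, so every nilpotent term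
  becomes a square of an odd variable.\<close>

lemma super_diff_delta_ZW:
  "dist_mult (*) super_diff delta_ZW = (0 :: ('n::{finite,linorder}, complex) dist_ZW)"
proof -
  have "dist_mult (*) (even_diff {}) formal_delta = (0 :: ('n, complex) dist_ZW)"
    by (intro ext) (auto simp: complex_scale.even_diff_mult dist_apply dist_mult_var_z
        dist_mult_var_w formal_delta_eq)
  then have "dist_mult (*) (even_diff {}) delta_ZW = (0 :: ('n, complex) dist_ZW)"
    unfolding delta_ZW_eq
    by (simp add: complex_scale.odd_mults_zero flip: complex_scale.odd_mults_even_diff)
  moreover have "dist_mult (*) (monomial_ZW 0 {i} 0 {i}) delta_ZW = 0" for i :: 'n
  proof -
    have "dist_mult (*) (var_\<zeta> i) delta_ZW = dist_mult (*) (var_\<theta> i) delta_ZW"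
      using odd_diff_delta_ZW [of i] by (simp add: complex_scale.odd_diff_mult)
    moreover have "dist_mult (*) (var_\<theta> i) (dist_mult (*) (var_\<theta> i) delta_ZW) = 0"
      by (intro ext) (simp add: complex_scale.dist_mult_monomial dist_apply)
    ultimately show ?thesis
      by (simp add: \<theta>_\<zeta>_mult)
  qed
  ultimately show ?thesis
    by (simp add: complex_scale.even_diff_mult)
qed

text \<open>If \<open>a\<close> is free of theta, the top coefficient arises by choosing the theta
  summand in every factor.\<close>

lemma odd_mults_sorted_coeff:
  assumes "\<And>n I m K. I \<noteq> {} \<Longrightarrow> a n I m K = 0" "sorted l" "distinct l"
  shows "\<not> I \<subseteq> set l \<Longrightarrow> odd_mults (*) l a n I m K = 0"
    and "odd_mults (*) l a n (set l) m K = a n {} m K"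
proof -
  have "(\<forall>n I m K. \<not> I \<subseteq> set l \<longrightarrow> odd_mults (*) l a n I m K = 0) \<and>
      (\<forall>n m K. odd_mults (*) l a n (set l) m K = a n {} m K)"
    using assms(2,3)
  proof (induction l)
    case Nil
    then show ?case
      using assms(1) by auto
  next
    case (Cons i l)
    then have IH: "\<not> I \<subseteq> set l \<Longrightarrow> odd_mults (*) l a n I m K = 0"
        "odd_mults (*) l a n (set l) m K = a n {} m K" for n I m K
      by auto
    have "odd_mults (*) (i # l) a n I m K = 0" if "\<not> I \<subseteq> set (i # l)" for n I m K
    proof -
      have "\<not> I \<subseteq> set l" "\<not> I - {i} \<subseteq> set l"
        using that by auto
      then show ?thesis
        by (simp add: complex_scale.odd_diff_mult dist_apply dist_mult_var_\<theta> dist_mult_var_\<zeta> IH(1))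
    qed
    moreover have "odd_mults (*) (i # l) a n (set (i # l)) m K = a n {} m K" for n m K
    proof -
      \<comment> \<open>As \<open>l\<close> is sorted, the new index is the smallest, so no sign
        appears.\<close>
      have "\<not> set (i # l) \<subseteq> set l" "insert i (set l) - {i} = set l" "{k \<in> insert i (set l). k < i} = {}"
        using Cons.prems by auto
      then show ?thesis
        using IH(1) [of "set (i # l)"]
        by (simp only: foldr.simps o_apply complex_scale.odd_diff_mult minus_apply dist_mult_var_\<theta>
            dist_mult_var_\<zeta> list.set IH(2)) simp
    qed
    ultimately show ?case
      by blast
  qed
  then show "\<not> I \<subseteq> set l \<Longrightarrow> odd_mults (*) l a n I m K = 0"
    "odd_mults (*) l a n (set l) m K = a n {} m K"
    by blast+
qed

lemma res_Z_delta_ZW: "res_Z (delta_ZW :: ('n::{finite,linorder}, complex) dist_ZW) = const_W 1"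
proof (intro ext)
  fix m and K :: "'n set"
  have "delta_ZW (-1) UNIV m K = formal_delta (-1) {} m K"
    using odd_mults_sorted_coeff(2) [of formal_delta "sorted_list_of_set (UNIV :: 'n set)" "-1" m K]
    by (simp add: delta_ZW_eq formal_delta_eq)
  then show "res_Z delta_ZW m K = const_W 1 m K"
    by (auto simp: res_Z_def const_W_def formal_delta_eq)
qed

text \<open>Satisfied by \<open>delta_ZW\<close> and its derivatives, which are not Laurent
  polynomials, and sufficient for multiplying by a distribution in \<open>W\<close>.\<close>

definition row_finite :: "('n, complex) dist_ZW \<Rightarrow> bool" where
  "row_finite a \<longleftrightarrow> (\<forall>n I. finite {m. \<exists>K. a n I m K \<noteq> 0})"

lemma row_finite_diff:
  assumes "row_finite a" "row_finite b"
  shows "row_finite (a - b)"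
  unfolding row_finite_def
proof (intro allI)
  fix n I
  have "finite ({m. \<exists>K. a n I m K \<noteq> 0} \<union> {m. \<exists>K. b n I m K \<noteq> 0})"
    using assms by (simp add: row_finite_def)
  then show "finite {m. \<exists>K. (a - b) n I m K \<noteq> 0}"
    by (rule rev_finite_subset) (auto simp: minus_apply)
qed

lemma row_finite_mult:
  assumes "laurent_poly p" "row_finite a"
  shows "row_finite (dist_mult (*) p a)"
  using assms(1)
proof (induction rule: laurent_poly_induct)
  case (monomial n0 I0 m0 K0)
  show ?case
    unfolding row_finite_def
  proof (intro allI)
    fix n I
    have "finite ((\<lambda>m. m + m0) ` {m. \<exists>K. a (n - n0) (I - I0) m K \<noteq> 0})"
      using assms(2) by (simp add: row_finite_def)
    then show "finite {m. \<exists>K. dist_mult (*) (monomial_ZW n0 I0 m0 K0) a n I m K \<noteq> 0}"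
    proof (rule rev_finite_subset, intro subsetI)
      fix m
      assume "m \<in> {m. \<exists>K. dist_mult (*) (monomial_ZW n0 I0 m0 K0) a n I m K \<noteq> 0}"
      then have "\<exists>K. a (n - n0) (I - I0) (m - m0) K \<noteq> 0"
        by (auto simp: complex_scale.dist_mult_monomial split: if_splits)
      then show "m \<in> (\<lambda>m. m + m0) ` {m. \<exists>K. a (n - n0) (I - I0) m K \<noteq> 0}"
        by (intro image_eqI [of _ _ "m - m0"]) auto
    qed
  qed
next
  case (diff p q)
  then show ?case
    by (simp add: complex_scale.poly_diff_mult row_finite_diff)
qed

lemma row_finite_deriv_w:
  assumes "row_finite a"
  shows "row_finite (deriv_w a)"
  unfolding row_finite_def
proof (intro allI)
  fix n I
  have "finite ((\<lambda>m. m - 1) ` {m. \<exists>K. a n I m K \<noteq> 0})"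
    using assms by (simp add: row_finite_def)
  then show "finite {m. \<exists>K. deriv_w a n I m K \<noteq> 0}"
  proof (rule rev_finite_subset, intro subsetI)
    fix m
    assume "m \<in> {m. \<exists>K. deriv_w a n I m K \<noteq> 0}"
    then show "m \<in> (\<lambda>m. m - 1) ` {m. \<exists>K. a n I m K \<noteq> 0}"
      by (intro image_eqI [of _ _ "m + 1"]) (auto simp: deriv_w_def)
  qed
qed

lemma row_finite_deriv_\<zeta>:
  assumes "row_finite a"
  shows "row_finite (deriv_\<zeta> i a)"
  unfolding row_finite_def
proof (intro allI)
  fix n I
  have "finite {m. \<exists>K. a n I m K \<noteq> 0}"
    using assms by (simp add: row_finite_def)
  then show "finite {m. \<exists>K. deriv_\<zeta> i a n I m K \<noteq> 0}"
    by (rule rev_finite_subset) (auto simp: deriv_\<zeta>_def split: if_splits)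
qed

lemma row_finite_D_W:
  assumes "row_finite a"
  shows "row_finite (D_W i a)"
proof -
  have "row_finite (0 :: ('n, complex) dist_ZW)"
    by (simp add: row_finite_def dist_apply)
  then have "row_finite (deriv_\<zeta> i a - (0 - dist_mult (*) (var_\<zeta> i) (deriv_w a)))"
    using assms
    by (intro row_finite_diff row_finite_deriv_\<zeta> row_finite_mult row_finite_deriv_w laurent_poly.monomial)
  then show ?thesis
    by (simp add: D_W_def)
qed

lemma row_finite_formal_delta: "row_finite formal_delta"
  unfolding row_finite_def
proof (intro allI)
  fix n I
  have "{m. \<exists>K. formal_delta n I m K \<noteq> 0} \<subseteq> {- 1 - n}"
    by (auto simp: formal_delta_eq split: if_splits)
  then show "finite {m. \<exists>K. formal_delta n I m K \<noteq> 0}"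
    by (meson finite.emptyI finite.insertI finite_subset)
qed

lemma row_finite_delta_ZW: "row_finite (delta_ZW :: ('n::{finite,linorder}, complex) dist_ZW)"
proof -
  have "row_finite (odd_mults (*) l formal_delta)" for l :: "'n list"
    by (induction l) (simp_all add: row_finite_formal_delta row_finite_mult laurent_poly_odd_diff)
  then show ?thesis
    unfolding delta_ZW_eq .
qed

lemma D_W_divided_eq:
  "D_W_divided j J a = scale_ZW ((-1) ^ (card J * (card J + 1) div 2) / fact j)
    ((deriv_w ^^ j) (D_Ws (sorted_list_of_set J) a))"
  by (simp add: D_W_divided_def scale_ZW_def D_W_power_def)

lemma row_finite_D_W_divided:
  assumes "row_finite a"
  shows "row_finite (D_W_divided j J a)"
proof -
  have "row_finite (D_Ws l a)" for l
    using assms by (induction l) (simp_all add: row_finite_D_W)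
  then have "row_finite ((deriv_w ^^ j) (D_Ws (sorted_list_of_set J) a))"
    by (induction j) (simp_all add: row_finite_deriv_w)
  then show ?thesis
    unfolding D_W_divided_eq by (simp add: row_finite_def scale_ZW_def)
qed

lemma super_diff_D_Ws_delta:
  "distinct l \<Longrightarrow> dist_mult (*) super_diff (D_Ws l delta_ZW) = 0"
  by (intro super_diff_D_Ws odd_diff_delta_ZW super_diff_delta_ZW)

lemma super_mults_D_W_divided_delta:
  "super_mults (*) (Suc j) (D_W_divided j J delta_ZW) = 0"
proof -
  have "super_mults (*) (Suc j) ((deriv_w ^^ j) (D_Ws (sorted_list_of_set J) delta_ZW)) = 0"
    by (intro super_mults_deriv_w_power_zero super_diff_D_Ws_delta) simp
  then show ?thesis
    by (simp only: D_W_divided_eq super_mults_scale_ZW scale_ZW_zero)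
qed

text \<open>Duality of divided derivatives and powers of \<open>Z - W\<close>. The odd factors are
  evaluated first, leaving a multiple of delta, a proper odd derivative of it up to sign, or zero;
  then the even factors act.\<close>

lemma res_Z_moment_D_W_divided_delta:
  fixes J J' :: "'n::{finite,linorder} set"
  shows "res_Z (super_mults (*) j (odd_mults (*) (sorted_list_of_set J)
      (D_W_divided j' J' delta_ZW))) = const_W (if j = j' \<and> J = J' then 1 else 0)"
proof -
  let ?l = "sorted_list_of_set J" and ?l' = "sorted_list_of_set J'"
  let ?v = "odd_mults (*) ?l (D_Ws ?l' delta_ZW)"
  let ?s = "(-1) ^ (card J' * (card J' + 1) div 2) :: complex"
  have v: "dist_mult (*) super_diff ?v = 0 \<and> res_Z ?v = const_W (if J = J' then ?s else 0)"
  proof (cases "J = J'")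
    case True
    then have "?v = scale_ZW ?s delta_ZW"
      using odd_mults_D_Ws_same [OF odd_diff_delta_ZW, of ?l'] by simp
    then show ?thesis
      using True res_Z_scale_ZW [OF res_Z_delta_ZW, of ?s]
      by (simp add: dist_mult_scale_ZW laurent_poly_even_diff super_diff_delta_ZW)
  next
    case neq: False
    show ?thesis
    proof (cases "J \<subseteq> J'")
      case True
      then obtain l'' where l'': "distinct l''" "set l'' = J' - J"
        "?v = D_Ws l'' delta_ZW \<or> ?v = - D_Ws l'' delta_ZW"
        using odd_mults_D_Ws [OF odd_diff_delta_ZW, of ?l' ?l] by auto
      then have "l'' \<noteq> []"
        using True neq by auto
      then have "res_Z (D_Ws l'' delta_ZW) = 0"
        using res_Z_D_Ws [OF res_Z_delta_ZW, of l''] by (simp add: const_W_0)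
      moreover note super_diff_D_Ws_delta [OF l''(1)]
      ultimately have "dist_mult (*) super_diff ?v = 0 \<and> res_Z ?v = 0"
        using l''(3)
        by (elim disjE) (simp_all add: res_Z_minus complex_scale.dist_mult_minus laurent_poly_even_diff)
      then show ?thesis
        using neq by (simp add: const_W_0)
    next
      case False
      then have "?v = 0"
        using odd_mults_D_Ws [OF odd_diff_delta_ZW, of ?l' ?l] by simp
      then show ?thesis
        using neq by (simp add: const_W_0)
    qed
  qed
  have "super_mults (*) j (odd_mults (*) ?l (D_W_divided j' J' delta_ZW)) =
      scale_ZW (?s / fact j') (super_mults (*) j ((deriv_w ^^ j') ?v))"
    by (simp only: D_W_divided_eq odd_mults_scale_ZW super_mults_scale_ZW deriv_w_power_odd_mults)
  then have "res_Z (super_mults (*) j (odd_mults (*) ?l (D_W_divided j' J' delta_ZW))) =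
      const_W (?s / fact j' * (if j = j' then fact j' * (if J = J' then ?s else 0) else 0))"
    using res_Z_scale_ZW [OF res_Z_super_mults_deriv_w_power [OF conjunct1 [OF v] conjunct2 [OF v]]]
    by simp
  \<comment> \<open>The normalising sign meets itself and squares to 1, and the factorials
    cancel.\<close>
  also have "?s / fact j' * (if j = j' then fact j' * (if J = J' then ?s else 0) else 0) =
      (if j = j' \<and> J = J' then 1 else 0)"
    by (simp flip: power_mult_distrib)
  finally show ?thesis .
qed

section \<open>Terms with vector-valued coefficients\<close>

context complex_vector_space
begin

lemma mult_defined_in_W:
  fixes c :: "('n::{finite,linorder}, 'u) dist_W"
  assumes "row_finite q"
  shows "mult_defined q (in_W c)"
  unfolding mult_defined_def
proof (intro allI)
  fix n I m K
  \<comment> \<open>As \<open>in_W c\<close> is free of \<open>z\<close>, the whole power of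
    \<open>z\<close> must come from \<open>q\<close>.\<close>
  have "contributions q (in_W c) n I m K \<subseteq> {n} \<times> UNIV \<times> (\<Union>I. {m. \<exists>K. q n I m K \<noteq> 0}) \<times> UNIV"
    by (auto simp: contributions_def in_W_def split: if_splits)
  moreover have "finite \<dots>"
    using assms by (simp add: row_finite_def)
  ultimately show "finite (contributions q (in_W c) n I m K)"
    by (rule finite_subset)
qed

text \<open>Only the constant term of the residue of \<open>q\<close> contributes, and since
  \<open>c\<close> stands on the right no variable of \<open>W\<close> has to cross a theta.\<close>

lemma res_Z_mult_in_W:
  fixes c :: "('n::{finite,linorder}, 'u) dist_W"
  assumes "res_Z q = const_W e"
  shows "res_Z (dist_mult scale q (in_W c)) = (\<lambda>m K. scale e (c m K))"
proof (intro ext)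
  fix m and K :: "'n set"
  have q: "q (-1) UNIV m K = (if m = 0 \<and> K = {} then e else 0)" for m K
    using assms by (simp add: res_Z_def const_W_def fun_eq_iff)
  let ?S = "{(-1 :: int, UNIV :: 'n set, 0 :: int, {} :: 'n set)}"
  have "contributions q (in_W c) (-1) UNIV m K \<subseteq> ?S"
  proof
    fix x
    assume "x \<in> contributions q (in_W c) (-1) UNIV m K"
    then obtain n' I' m' K' where x: "x = (n', I', m', K')" "n' = -1" "I' = UNIV" "q n' I' m' K' \<noteq> 0"
      by (auto simp: contributions_def in_W_def top_unique split: if_splits)
    then have "q (-1) UNIV m' K' \<noteq> 0"
      by simp
    then have "m' = 0 \<and> K' = {}"
      unfolding q by (metis (full_types))
    with x show "x \<in> ?S"
      by simp
  qed
  then have "dist_mult scale q (in_W c) (-1) UNIV m K = (\<Sum>(n', I', m', K')\<in>?S.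
      scale (koszul_sign I' K' (UNIV - I') (K - K') * q n' I' m' K')
        (in_W c (- 1 - n') (UNIV - I') (m - m') (K - K')))"
    by (intro dist_mult_eq_sum) auto
  then show "res_Z (dist_mult scale q (in_W c)) m K = scale e (c m K)"
    by (simp add: res_Z_def in_W_def q koszul_sign_def)
qed

lemma super_mults_delta_term:
  "super_mults scale (Suc j) (dist_mult scale (D_W_divided j J delta_ZW) (in_W c)) = 0"
proof -
  have "super_mults scale (Suc j) (dist_mult scale (D_W_divided j J delta_ZW) (in_W c)) =
      dist_mult scale (super_mults (*) (Suc j) (D_W_divided j J delta_ZW)) (in_W c)"
    by (intro super_mults_mult [symmetric] mult_defined_in_W row_finite_D_W_divided row_finite_delta_ZW)
  then show ?thesis
    by (simp only: super_mults_D_W_divided_delta dist_mult_zero_left)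
qed

lemma res_Z_moment_delta_term:
  "res_Z (super_mults scale j (odd_mults scale (sorted_list_of_set J)
      (dist_mult scale (D_W_divided j' J' delta_ZW) (in_W c)))) = (if j = j' \<and> J = J' then c else 0)"
proof -
  let ?d = "D_W_divided j' J' delta_ZW" and ?l = "sorted_list_of_set J"
  have d: "mult_defined ?d (in_W c)"
    by (intro mult_defined_in_W row_finite_D_W_divided row_finite_delta_ZW)
  have "res_Z (super_mults scale j (odd_mults scale ?l (dist_mult scale ?d (in_W c)))) =
      res_Z (dist_mult scale (super_mults (*) j (odd_mults (*) ?l ?d)) (in_W c))"
    by (simp only: super_mults_mult odd_mults_mult d)
  also have "\<dots> = (\<lambda>m K. scale (if j = j' \<and> J = J' then 1 else 0) (c m K))"
    by (intro res_Z_mult_in_W res_Z_moment_D_W_divided_delta)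
  also have "\<dots> = (if j = j' \<and> J = J' then c else 0)"
  proof -
    have "(\<lambda>m K. scale (if P then 1 else 0) (c m K)) = (if P then c else 0)" for P
      by (cases P) (simp_all add: zero_fun_def)
    then show ?thesis .
  qed
  finally show ?thesis .
qed

abbreviation moment :: "nat \<Rightarrow> 'n::{finite,linorder} set \<Rightarrow> ('n, 'u) dist_ZW \<Rightarrow> ('n, 'u) dist_W" where
  "moment j J a \<equiv> res_Z (super_mults scale j (odd_mults scale (sorted_list_of_set J) a))"

lemma moment_diff: "moment j J (a - b) = moment j J a - moment j J b"
  by (simp add: odd_mults_diff super_mults_diff res_Z_diff)

lemma moment_zero: "moment j J 0 = 0"
  by (simp add: odd_mults_zero super_mults_zero)

lemma moment_sum: "moment j J (sum f S) = (\<Sum>x\<in>S. moment j J (f x))"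
proof (induction S rule: infinite_finite_induct)
  case (insert x S)
  have "moment j J (f x - (0 - sum f S)) = moment j J (f x) - (0 - moment j J (sum f S))"
    by (simp only: moment_diff moment_zero)
  then show ?case
    using insert by simp
qed (simp_all add: moment_zero)

text \<open>Duality isolates a single term; this yields both uniqueness and the coefficient
  formula.\<close>

lemma moment_decomposition:
  assumes "finite {(j, J). c j J \<noteq> (0 :: ('n::{finite,linorder}, 'u) dist_W)}"
  shows "moment j J (\<Sum>(j, J)\<in>{(j, J). c j J \<noteq> 0}.
    dist_mult scale (D_W_divided j J delta_ZW) (in_W (c j J))) = c j J"
proof -
  have "moment j J (\<Sum>(j, J)\<in>{(j, J). c j J \<noteq> 0}.
      dist_mult scale (D_W_divided j J delta_ZW) (in_W (c j J))) =
    (\<Sum>x\<in>{(j, J). c j J \<noteq> 0}. if x = (j, J) then c j J else 0)"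
    unfolding moment_sum by (intro sum.cong) (auto simp: res_Z_moment_delta_term)
  also have "\<dots> = c j J"
    using assms by (simp add: sum.delta')
  finally show ?thesis .
qed

section \<open>Existence and uniqueness of the decomposition\<close>

lemma super_mults_mono:
  assumes "super_mults scale k a = 0" "k \<le> j"
  shows "super_mults scale j a = 0"
proof -
  have "super_mults scale (j - k + k) a = super_mults scale (j - k) (super_mults scale k a)"
    by (simp only: funpow_add o_apply)
  then show ?thesis
    using assms by (simp only: super_mults_zero le_add_diff_inverse2)
qed

lemma super_local_sum:
  assumes "\<And>x. x \<in> S \<Longrightarrow> \<exists>k. super_mults scale k (f x) = 0"
  shows "\<exists>k. super_mults scale k (sum f S) = 0"
  using assms
proof (induction S rule: infinite_finite_induct)
  case (insert x S)
  then obtain k k' where "super_mults scale k (f x) = 0" "super_mults scale k' (sum f S) = 0"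
    by (metis insertCI)
  then have "super_mults scale (max k k') (f x) = 0" "super_mults scale (max k k') (sum f S) = 0"
    by (auto intro: super_mults_mono)
  then have "super_mults scale (max k k') (f x - (0 - sum f S)) = 0"
    by (simp only: super_mults_diff super_mults_zero) simp
  then show ?case
    using insert.hyps by auto
qed (auto intro: exI [of _ 0])

lemma delta_decomposition_exists:
  fixes a :: "('n::{finite,linorder}, 'u) dist_ZW"
  assumes "local_dist scale a"
  shows "is_delta_decomposition scale a (\<lambda>j J. moment j J a)"
proof -
  let ?c = "\<lambda>j J. moment j J a"
  let ?S = "{(j, J). ?c j J \<noteq> 0}"
  define e where
    "e = (\<Sum>(j, J)\<in>?S. dist_mult scale (D_W_divided j J delta_ZW) (in_W (?c j J)))"
  obtain k where k: "super_mults scale k a = 0"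
    using assms by (auto simp: local_dist_iff)
  \<comment> \<open>Locality makes the sum finite: the even factors commute with the odd ones and
    already kill \<open>a\<close>.\<close>
  have "?c j J = 0" if "k \<le> j" for j J
    using super_mults_mono [OF k that] by (simp add: super_mults_odd_mults odd_mults_zero)
  then have "?S \<subseteq> {..<k} \<times> UNIV"
    by (auto simp: not_le [symmetric])
  then have S: "finite ?S"
    by (rule finite_subset) simp
  \<comment> \<open>Each term with index \<open>j\<close> is killed by \<open>Suc j\<close> even
    factors, so the finite sum is local.\<close>
  have "\<exists>k. super_mults scale k e = 0"
    unfolding e_def
  proof (intro super_local_sum)
    fix x :: "nat \<times> 'n set"
    obtain j J where "x = (j, J)"
      by (cases x)
    then show "\<exists>k. super_mults scale k
        (case x of (j, J) \<Rightarrow> dist_mult scale (D_W_divided j J delta_ZW) (in_W (?c j J))) = 0"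
      using super_mults_delta_term [of j J "?c j J"] by (simp only: prod.case) (rule exI)
  qed
  then obtain k' where k': "super_mults scale k' e = 0" ..
  have "super_mults scale (max k k') (a - e) = 0"
    by (simp add: super_mults_diff super_mults_mono [OF k] super_mults_mono [OF k'])
  \<comment> \<open>Back to \<open>z - w\<close>, which is what the vanishing criterion
    requires.\<close>
  then obtain r where r: "(dist_mult scale (even_diff {}) ^^ r) (a - e) = 0"
    using even_diff_nilpotent_iff [of UNIV "a - e"] by auto
  have "moments_vanish (a - e)"
    unfolding moments_vanish_def moment_diff e_def moment_decomposition [OF S] by simp
  from moments_vanish_local_imp_zero [OF this r] have "a = e"
    by simp
  then show ?thesis
    unfolding is_delta_decomposition_def using S e_def by simp
qed

lemma delta_decomposition_unique:
  assumes "is_delta_decomposition scale a c"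
  shows "c j J = moment j J a"
  using assms moment_decomposition [of c j J] unfolding is_delta_decomposition_def by metis

end

theorem lemma4p6:
  fixes scale :: "complex \<Rightarrow> 'u::ab_group_add \<Rightarrow> 'u"
    and U_even U_odd :: "'u set"
    and a :: "('n::{finite,linorder}, 'u) dist_ZW"
  assumes "vector_superspace scale U_even U_odd"
    and "local_dist scale a"
  shows "(\<exists>!c :: nat \<Rightarrow> 'n set \<Rightarrow> ('n, 'u) dist_W. is_delta_decomposition scale a c) \<and>
    (\<forall>c :: nat \<Rightarrow> 'n set \<Rightarrow> ('n, 'u) dist_W. is_delta_decomposition scale a c \<longrightarrow>
      (\<forall>j J. c j J = res_Z (dist_mult scale (ZW_diff_power j J) a)))"
proof -
  interpret vector_superspace scale U_even U_odd
    by fact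
  interpret complex_vector_space scale
    by unfold_locales
  show ?thesis
    \<comment> \<open>The residues in the coefficient formula become instances of
      \<open>moment\<close>.\<close>
    unfolding ZW_diff_power_mult
  proof (intro conjI allI impI ex1I)
    show "is_delta_decomposition scale a (\<lambda>j J. moment j J a)"
      using assms(2) by (rule delta_decomposition_exists)
  next
    fix c :: "nat \<Rightarrow> 'n set \<Rightarrow> ('n, 'u) dist_W"
    assume c: "is_delta_decomposition scale a c"
    then show *: "c j J = moment j J a" for j J
      by (rule delta_decomposition_unique)
    show "c = (\<lambda>j J. moment j J a)"
      by (intro ext) (simp only: *)
  qed
qed

end
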